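(* Let $L>0$, $\beta\in(0,1)$ and $\lambda>0$. Let $u_0:[0,L]\to[0,\infty)$ be a bounded measurable function which is strictly positive on a set of positive Lebesgue measure, and let $\sigma:\mathbf{R}\to\mathbf{R}$ be globally Lipschitz with $l_\sigma|x|\le|\sigma(x)|\le L_\sigma|x|$ for all $x\in\mathbf{R}$, where $l_\sigma,L_\sigma>0$ are constants. Let $u_t(x)$ be the unique solution of $$u_t(x)=(\mathcal{G}_Du_0)_t(x)+\lambda\int_0^L\int_0^t G_D(t-s,x,y)\,\sigma(u_s(y))\,W(ds,dy),\qquad t>0,\ x\in[0,L].$$ Then, for every $\lambda>0$, the second moment of $u_t$ does not decay exponentially fast: there are no constants $C,\gamma,T>0$ such that $\sup_{x\in[0,L]}\mathbb{E}|u_t(x)|^2\le Ce^{-\gamma t}$ for all $t\ge T$. If moreover $\beta\in(0,\tfrac12]$, then for every $\lambda>0$ the quantity $\sup_{x\in[0,L]}\mathbb{E}|u_t(x)|^2$ grows exponentially fast as $t\to\infty$: there exist constants $c,\gamma,T>0$ such that $\sup_{x\in[0,L]}\mathbb{E}|u_t(x)|^2\ge ce^{\gamma t}$ for all $t\ge T$.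
   Context: The equation is the mild (Walsh) formulation of the fractional-time stochastic heat equation $\partial_t^\beta u_t(x)=\frac12\partial_{xx}u_t(x)+I_t^{1-\beta}[\lambda\sigma(u_t(x))\dot W(t,x)]$ on $(0,L)$, $t>0$, with $u_t(0)=u_t(L)=0$ and initial condition $u_0$, where $\partial_t^\beta$ is the Caputo derivative and $I_t^{1-\beta}f(t)=\frac1{\Gamma(1-\beta)}\int_0^t(t-\tau)^{-\beta}f(\tau)\,d\tau$. Only the mild formulation is used. $\dot W$ is space-time white noise on $(0,\infty)\times[0,L]$ and the stochastic integral is in the sense of Walsh. "Unique solution" means the predictable random field satisfying the integral equation almost surely for each $(t,x)$, with $\sup_{0<t\le T}\sup_{x\in[0,L]}\mathbb{E}|u_t(x)|^2<\infty$ for every $T>0$; existence and uniqueness (up to modification) are taken as known. Kernel: $\phi_n(x)=\left(\frac2L\right)^{1/2}\sin\left(\frac{n\pi x}{L}\right)$, $\mu_n=\frac12\left(\frac{n\pi}{L}\right)^2$ (the Dirichlet eigenvalues of $-\frac12\partial_{xx}$ on $(0,L)$), $n\ge1$; $E_\beta(z)=\sum_{k\ge0}\frac{z^k}{\Gamma(1+\beta k)}$ is the Mittag-Leffler function; and $$G_D(t,x,y)=\sum_{n=1}^\infty E_\beta(-\mu_nt^\beta)\phi_n(x)\phi_n(y),\qquad (\mathcal{G}_Du_0)_t(x)=\int_0^LG_D(t,x,y)u_0(y)\,dy .$$ Equivalently, $G_D(t,x,\cdot)$ is the transition density of Brownian motion killed on exiting $[0,L]$, time-changed by the inverse of an independent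 $\beta$-stable subordinator. *)

theory Defs
  imports "HOL-Probability.Probability"
begin

section \<open>The Dirichlet heat kernel of the time-fractional equation\<close>

definition mittag_leffler :: "real \<Rightarrow> real \<Rightarrow> real" where
  "mittag_leffler \<beta> z = (\<Sum>k. z ^ k / Gamma (1 + \<beta> * real k))"

definition dir_eigenfun :: "real \<Rightarrow> nat \<Rightarrow> real \<Rightarrow> real" where
  "dir_eigenfun L n x = sqrt (2 / L) * sin (real n * pi * x / L)"

definition dir_eigenval :: "real \<Rightarrow> nat \<Rightarrow> real" where
  "dir_eigenval L n = (real n * pi / L)\<^sup>2 / 2"

definition G_D :: "real \<Rightarrow> real \<Rightarrow> real \<Rightarrow> real \<Rightarrow> real \<Rightarrow> real" where
  "G_D L \<beta> t x y = (\<Sum>n. mittag_leffler \<beta> (- dir_eigenval L (Suc n) * t powr \<beta>)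
                        * dir_eigenfun L (Suc n) x * dir_eigenfun L (Suc n) y)"

definition G_D_op :: "real \<Rightarrow> real \<Rightarrow> (real \<Rightarrow> real) \<Rightarrow> real \<Rightarrow> real \<Rightarrow> real" where
  "G_D_op L \<beta> u0 t x = (LINT y|lebesgue_on {0..L}. G_D L \<beta> t x y * u0 y)"


section \<open>Space-time white noise\<close>

definition noise_sets :: "real \<Rightarrow> (real \<times> real) set set" where
  "noise_sets L = {A \<in> sets borel. A \<subseteq> {0<..} \<times> {0..L} \<and> emeasure lborel A < \<infinity>}"

text \<open>
  \<open>F\<close> is any filtration for which \<open>W\<close> is adapted with increments independent of the past; the
  filtration generated by \<open>W\<close> is one instance. The usual conditions are not required. The index
  set of \<open>F\<close> is the whole real line because that is what the library's filtrations provide for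
  real time; only times \<open>t \<ge> 0\<close> matter. The law is stated by cases because
  \<^const>\<open>normal_density\<close> does not describe the degenerate distribution \<open>N(0,0)\<close>.
\<close>

locale white_noise = prob_space M + filtration "space M" F
  for M :: "'a measure" and F :: "real \<Rightarrow> 'a measure" +
  fixes L :: real and W :: "(real \<times> real) set \<Rightarrow> 'a \<Rightarrow> real"
  assumes F_subset: "sets (F t) \<subseteq> sets M"
    and measurable_W: "A \<in> noise_sets L \<Longrightarrow> W A \<in> borel_measurable M"
    and normal_W: "\<lbrakk>A \<in> noise_sets L; measure lborel A > 0\<rbrakk>
        \<Longrightarrow> distributed M lborel (W A) (normal_density 0 (sqrt (measure lborel A)))"
    and null_W: "\<lbrakk>A \<in> noise_sets L; measure lborel A = 0\<rbrakk> \<Longrightarrow> AE \<omega> in M. W A \<omega> = 0"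
    and additive_W: "\<lbrakk>A \<in> noise_sets L; B \<in> noise_sets L; A \<inter> B = {}\<rbrakk>
        \<Longrightarrow> AE \<omega> in M. W (A \<union> B) \<omega> = W A \<omega> + W B \<omega>"
    and indep_W: "\<lbrakk>finite \<A>; \<A> \<subseteq> noise_sets L; disjoint \<A>\<rbrakk>
        \<Longrightarrow> indep_vars (\<lambda>_. borel) W \<A>"
    and adapted_W: "\<lbrakk>0 \<le> t; A \<in> noise_sets L; A \<subseteq> {0<..t} \<times> {0..L}\<rbrakk>
        \<Longrightarrow> W A \<in> borel_measurable (F t)"
    and indep_future_W: "0 \<le> t \<Longrightarrow>
        indep_set (sets (F t))
          (sigma_sets (space M)
            {W A -` B \<inter> space M | A B.
               A \<in> noise_sets L \<and> A \<subseteq> {t<..} \<times> {0..L} \<and> B \<in> sets borel})"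


section \<open>Walsh integral\<close>

text \<open>Random fields on \<open>(0,\<infinity>) \<times> [0,L]\<close> are regarded as functions of \<open>(s, y, \<omega>)\<close>.\<close>

definition predictable :: "'a measure \<Rightarrow> (real \<Rightarrow> 'a measure) \<Rightarrow> real \<Rightarrow> (real \<times> real \<times> 'a) measure" where
  "predictable M F L = sigma ({0<..} \<times> {0..L} \<times> space M)
     {{a<..b} \<times> A \<times> H | a b A H. 0 \<le> a \<and> A \<in> sets borel \<and> A \<subseteq> {0..L} \<and> H \<in> sets (F a)}"

definition field_measure :: "'a measure \<Rightarrow> real \<Rightarrow> (real \<times> real \<times> 'a) measure" where
  "field_measure M L = restrict_space lborel {0<..} \<Otimes>\<^sub>M (restrict_space lborel {0..L} \<Otimes>\<^sub>M M)"

text \<open>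
  \<open>(X, a, b, A)\<close> stands for the elementary field \<open>X(\<omega>) 1\<^bsub>(a,b]\<^esub>(s) 1\<^bsub>A\<^esub>(y)\<close> and a list of such
  tuples for the sum of its members.
\<close>

type_synonym 'a simple_field = "(('a \<Rightarrow> real) \<times> real \<times> real \<times> real set) list"

definition simple_field :: "'a measure \<Rightarrow> (real \<Rightarrow> 'a measure) \<Rightarrow> real \<Rightarrow> 'a simple_field \<Rightarrow> bool" where
  "simple_field M F L es \<longleftrightarrow>
     (\<forall>(X, a, b, A) \<in> set es. 0 \<le> a \<and> a \<le> b \<and> A \<in> sets borel \<and> A \<subseteq> {0..L} \<and>
        X \<in> borel_measurable (F a) \<and> bounded (X ` space M))"

definition simple_field_fun :: "'a simple_field \<Rightarrow> real \<times> real \<times> 'a \<Rightarrow> real" where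
  "simple_field_fun es = (\<lambda>(s, y, \<omega>).
     (\<Sum>(X, a, b, A)\<leftarrow>es. X \<omega> * indicator {a<..b} s * indicator A y))"

definition simple_walsh_integral ::
    "((real \<times> real) set \<Rightarrow> 'a \<Rightarrow> real) \<Rightarrow> 'a simple_field \<Rightarrow> 'a \<Rightarrow> real" where
  "simple_walsh_integral W es \<omega> = (\<Sum>(X, a, b, A)\<leftarrow>es. X \<omega> * W ({a<..b} \<times> A) \<omega>)"

text \<open>
  The integral of a square-integrable predictable field over \<open>(0,\<infinity>) \<times> [0,L]\<close> is the
  \<open>L\<^sup>2\<close>-limit of the integrals of approximating simple fields. It is unique only up to
  almost sure equality, hence a relation.
\<close>

definition has_walsh_integral ::
    "'a measure \<Rightarrow> (real \<Rightarrow> 'a measure) \<Rightarrow> real \<Rightarrow> ((real \<times> real) set \<Rightarrow> 'a \<Rightarrow> real)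
      \<Rightarrow> (real \<times> real \<times> 'a \<Rightarrow> real) \<Rightarrow> ('a \<Rightarrow> real) \<Rightarrow> bool" where
  "has_walsh_integral M F L W f I \<longleftrightarrow>
     f \<in> borel_measurable (predictable M F L) \<and>
     (\<integral>\<^sup>+ p. ennreal ((f p)\<^sup>2) \<partial>field_measure M L) < \<infinity> \<and>
     I \<in> borel_measurable M \<and>
     (\<exists>es :: nat \<Rightarrow> 'a simple_field.
        (\<forall>n. simple_field M F L (es n)) \<and>
        (\<lambda>n. \<integral>\<^sup>+ p. ennreal ((simple_field_fun (es n) p - f p)\<^sup>2) \<partial>field_measure M L)
          \<longlonglongrightarrow> 0 \<and>
        (\<lambda>n. \<integral>\<^sup>+ \<omega>. ennreal ((simple_walsh_integral W (es n) \<omega> - I \<omega>)\<^sup>2) \<partial>M)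
          \<longlonglongrightarrow> 0)"


section \<open>Mild solutions\<close>

text \<open>Second moments take values in \<^typ>\<open>ennreal\<close>, so that they and their suprema are never
  undefined.\<close>

definition second_moment :: "'a measure \<Rightarrow> ('a \<Rightarrow> real) \<Rightarrow> ennreal" where
  "second_moment M X = (\<integral>\<^sup>+ \<omega>. ennreal (\<bar>X \<omega>\<bar>\<^sup>2) \<partial>M)"

definition mild_solution ::
    "'a measure \<Rightarrow> (real \<Rightarrow> 'a measure) \<Rightarrow> real \<Rightarrow> ((real \<times> real) set \<Rightarrow> 'a \<Rightarrow> real)
      \<Rightarrow> real \<Rightarrow> real \<Rightarrow> (real \<Rightarrow> real) \<Rightarrow> (real \<Rightarrow> real) \<Rightarrow> (real \<Rightarrow> real \<Rightarrow> 'a \<Rightarrow> real) \<Rightarrow> bool" where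
  "mild_solution M F L W \<beta> lam \<sigma> u0 u \<longleftrightarrow>
     (\<lambda>(t, x, \<omega>). u t x \<omega>) \<in> borel_measurable (predictable M F L) \<and>
     (\<forall>T>0. (SUP t\<in>{0<..T}. SUP x\<in>{0..L}. second_moment M (u t x)) < \<infinity>) \<and>
     (\<forall>t>0. \<forall>x\<in>{0..L}. \<exists>I.
        has_walsh_integral M F L W
          (\<lambda>(s, y, \<omega>). indicator {0<..<t} s * G_D L \<beta> (t - s) x y * \<sigma> (u s y \<omega>)) I \<and>
        (AE \<omega> in M. u t x \<omega> = G_D_op L \<beta> u0 t x + lam * I \<omega>))"

end

theory Submission
  imports Defs "HOL-Real_Asymp.Real_Asymp"
begin

text \<open>
  Walsh's isometry turns the mild equation into a lower bound for \<open>v t x = E|u t x|\<^sup>2\<close>: it is at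
  least the square of the deterministic part plus \<open>(lam l)\<^sup>2\<close> times the space-time integral of
  \<open>(G_D (t - s) x y)\<^sup>2 v s y\<close>. Weighting with the square of the first eigenfunction
  \<open>\<phi>\<close> and using the Cauchy--Schwarz inequality in \<open>x\<close> to bound the integral of
  \<open>(\<phi> x G_D (t - s) x y)\<^sup>2\<close> below by \<open>(e (t - s) \<phi> y)\<^sup>2 / L\<close>, where
  \<open>e t = E\<^sub>\<beta>(-\<mu>\<^sub>1 t\<^sup>\<beta>)\<close>, one obtains for the weighted moment \<open>m\<close> the scalar
  renewal inequality \<open>m t \<ge> A (e t)\<^sup>2 + B \<integral> (e (t - s))\<^sup>2 m s ds\<close> over \<open>0 < s < t\<close>.

  Since \<open>e t\<close> decays no faster than \<open>t\<^sup>-\<^sup>\<beta>\<close>, the first term alone excludes exponential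
  decay. For \<open>\<beta> \<le> 1/2\<close> the function \<open>e\<^sup>2\<close> is not integrable at infinity, so the renewal
  kernel \<open>B e\<^sup>2\<close> has infinite mass for every \<open>lam\<close>, which forces exponential growth.
\<close>

section \<open>The Mittag-Leffler function on the negative half-line\<close>

text \<open>The weight \<phi>^2 is what closes the inequality on itself. Integrating \<phi>(x)
  G_D(t-s,x,y) in x, without squares, reproduces \<phi>(y) with the factor e(t-s), because all other
  modes are orthogonal to \<phi>. Cauchy-Schwarz against the constant 1 on [0,L], which costs the
  factor 1/L, carries this over to squares, and the weight found at time s is \<phi>^2 again. As
  \<phi>^2 has integral 1, the weighted moment is at most the supremum over x, which transfers both
  conclusions. The analytic obstacle is the Mittag-Leffler function itself: it is given by an
  alternating power series in which neither sign nor decay at infinity can be seen term by term.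
  Both are read off from the linear Volterra equations that such series satisfy. On the
  probabilistic side moments stay in \<open>ennreal\<close>, and only the lower half of the isometry
  is carried to the L^2 limit.\<close>

lemma Gamma_real_ge:
  fixes x A :: real
  assumes "x \<ge> 1" "A > 0"
  shows "A powr (x - 1) * exp (- A) \<le> Gamma x"
\<comment> \<open>Of Euler's integral only the part over [A,\<infinity>) is kept, where t powr (x -
  1) is at least A powr (x - 1) because x >= 1. The cut-off A is free; a large A makes Gamma outgrow
  any given geometric sequence.\<close>
proof (rule has_integral_le)
  have "((\<lambda>t. A powr (x - 1) * exp (- 1 * t)) has_integral A powr (x - 1) * (exp (- 1 * A) / 1)) {A..}"
    by (intro has_integral_mult_right has_integral_exp_minus_to_infinity) auto
  then have "((\<lambda>t. A powr (x - 1) * exp (- t)) has_integral A powr (x - 1) * exp (- A)) {A..}"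
    by simp
  moreover have "{A..} \<subseteq> {0..}" using assms by auto
  ultimately show "((\<lambda>t. if t \<in> {A..} then A powr (x - 1) * exp (- t) else 0)
      has_integral A powr (x - 1) * exp (- A)) {0..}"
    by (subst has_integral_restrict)
  show "((\<lambda>t. t powr (x - 1) / exp t) has_integral Gamma x) {0..}"
    using assms by (intro Gamma_integral_real) auto
  show "(if t \<in> {A..} then A powr (x - 1) * exp (- t) else 0) \<le> t powr (x - 1) / exp t"
    if "t \<in> {0..}" for t
    using assms that by (auto simp: exp_minus field_simps intro!: powr_mono2)
qed

lemma summable_power_div_Gamma:
  fixes r \<beta> b :: real
  assumes "\<beta> > 0" "b > 0"
  shows "summable (\<lambda>k. r ^ k / Gamma (\<beta> * real k + b))"
proof -
  \<comment> \<open>Chosen so that A powr \<beta> = 2 (|r| + 1): the lower bound for Gamma then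
    grows like (2 (|r| + 1))^k and leaves the ratio (1/2)^k.\<close>
  define A where "A = (2 * (\<bar>r\<bar> + 1)) powr (1 / \<beta>)"
  have A: "A > 0" "A powr \<beta> = 2 * (\<bar>r\<bar> + 1)"
    using assms by (auto simp: A_def powr_powr)
  obtain N :: nat where N: "real N \<ge> 1 / \<beta>" using real_arch_simple by blast
  have bd: "norm (r ^ k / Gamma (\<beta> * real k + b)) \<le> exp A * A powr (1 - b) * (1/2) ^ k"
    if k: "k \<ge> N" for k
  proof -
    have "1 \<le> \<beta> * real N" using N assms by (simp add: field_simps)
    also have "\<dots> \<le> \<beta> * real k" using k assms by simp
    finally have x: "\<beta> * real k + b \<ge> 1" using assms by simp
    have "A powr (\<beta> * real k + b - 1) = A powr (b - 1) * (2 * (\<bar>r\<bar> + 1)) ^ k"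
    proof -
      have "A powr (\<beta> * real k + b - 1) = A powr (b - 1) * (A powr \<beta>) powr real k"
        by (simp add: powr_powr powr_add[symmetric] algebra_simps)
      then show ?thesis using A by (simp add: powr_realpow)
    qed
    then have G: "A powr (b - 1) * (2 * (\<bar>r\<bar> + 1)) ^ k * exp (- A) \<le> Gamma (\<beta> * real k + b)"
      using Gamma_real_ge[OF x A(1)] by simp
    have "norm (r ^ k / Gamma (\<beta> * real k + b)) = \<bar>r\<bar> ^ k / Gamma (\<beta> * real k + b)"
      using x by (simp add: power_abs)
    also have "\<dots> \<le> (\<bar>r\<bar> + 1) ^ k / (A powr (b - 1) * (2 * (\<bar>r\<bar> + 1)) ^ k * exp (- A))"
      using G A by (intro frac_le power_mono) (auto intro!: mult_pos_pos zero_less_power)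
    also have "\<dots> = exp A * A powr (1 - b) * (1/2) ^ k"
      unfolding power_mult_distrib[of 2]
      using A(1) by (simp add: exp_minus powr_diff field_simps power_divide)
    finally show ?thesis .
  qed
  show ?thesis
  proof (rule summable_comparison_test)
    show "\<exists>N. \<forall>k\<ge>N. norm (r ^ k / Gamma (\<beta> * real k + b)) \<le> exp A * A powr (1 - b) * (1/2) ^ k"
      using bd by blast
  qed (intro summable_mult summable_geometric, simp)
qed

text \<open>Scaling s = t x reduces this to Euler's Beta integral; it is the fractional integral of
  a power. The Bochner form also records integrability, since both endpoints are singular when a, b
  < 1.\<close>

lemma has_bochner_integral_Beta_convolution:
  fixes a b t :: real
  assumes "a > 0" "b > 0" "t > 0"
  shows "has_bochner_integral lborel (\<lambda>s. indicator {0..t} s * ((t - s) powr (a - 1) * s powr (b - 1)))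
     (Gamma a * Gamma b / Gamma (a + b) * t powr (a + b - 1))"
proof -
  have int: "set_integrable lborel {0..1} (\<lambda>t. t powr (b - 1) * (1 - t) powr (a - 1))"
    using integrable_Beta[of b a] assms by simp
  then have "(LINT s:{0..1}|lborel. s powr (b - 1) * (1 - s) powr (a - 1)) = Beta b a"
    using set_borel_integral_eq_integral[OF int] has_integral_Beta_real[of b a] assms
    by (simp add: integral_unique)
  then have "has_bochner_integral lborel (\<lambda>x. indicator {0..1} x * (x powr (b - 1) * (1 - x) powr (a - 1))) (Beta b a)"
    using int by (simp add: has_bochner_integral_iff set_integrable_def set_lebesgue_integral_def)
  then have "has_bochner_integral lborel
      (\<lambda>x. t powr (a + b - 2) * (indicator {0..1} x * (x powr (b - 1) * (1 - x) powr (a - 1))))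
      (t powr (a + b - 2) * Beta b a)"
    by (intro has_bochner_integral_mult_right)
  moreover have "t powr (a + b - 2) * (indicator {0..1} x * (x powr (b - 1) * (1 - x) powr (a - 1)))
     = indicator {0..t} (0 + t * x) * ((t - (0 + t * x)) powr (a - 1) * (0 + t * x) powr (b - 1))" for x
  proof (cases "0 \<le> x \<and> x \<le> 1")
    case True
    have "(t - t * x) = t * (1 - x)" by (simp add: algebra_simps)
    moreover have "t powr (a + b - 2) = t powr (a - 1) * t powr (b - 1)"
      using assms by (simp add: powr_add[symmetric])
    ultimately show ?thesis using True assms
      by (simp add: powr_mult indicator_def mult_le_cancel_left1)
  next
    case False then show ?thesis using assms by (auto simp: indicator_def zero_le_mult_iff)
  qed
  moreover have "t powr (a + b - 2) * Beta b a = (Gamma a * Gamma b / Gamma (a + b) * t powr (a + b - 1)) / \<bar>t\<bar>"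
    using assms by (simp add: Beta_def powr_diff powr_add field_simps power2_eq_square)
  ultimately show ?thesis
    using assms by (subst lborel_has_bochner_integral_real_affine_iff[of t _ _ 0]) (simp_all add: divide_inverse mult_ac)
qed

text \<open>\<open>t powr (b - 1) * E\<^bsub>\<beta>,b\<^esub>(- \<mu> * t powr \<beta>)\<close>, with the two-parameter Mittag-Leffler function
  \<open>E\<^bsub>\<beta>,b\<^esub>\<close>. The fractional integral of order \<open>a\<close> maps index \<open>b\<close> to \<open>a + b\<close>, so all the bounds below
  follow from the positivity of the kernel of index \<open>\<beta>\<close>.\<close>

definition ml_kernel :: "real \<Rightarrow> real \<Rightarrow> real \<Rightarrow> real \<Rightarrow> real" where
  "ml_kernel \<beta> \<mu> b t = (\<Sum>k. (- \<mu>) ^ k * t powr (\<beta> * real k + b - 1) / Gamma (\<beta> * real k + b))"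

lemma ml_kernel_term:
  fixes t :: real
  assumes "t > 0"
  shows "c ^ k * t powr (\<beta> * real k + b - 1) / Gamma (\<beta> * real k + b)
    = t powr (b - 1) * ((c * t powr \<beta>) ^ k / Gamma (\<beta> * real k + b))"
proof -
  have "t powr (\<beta> * real k + b - 1) = t powr (b - 1) * (t powr \<beta>) ^ k"
    using assms by (simp add: powr_realpow[symmetric] powr_powr powr_add[symmetric] algebra_simps)
  then show ?thesis by (simp add: power_mult_distrib)
qed

lemma summable_ml_kernel:
  fixes t :: real
  assumes "\<beta> > 0" "b > 0" "t > 0"
  shows "summable (\<lambda>k. c ^ k * t powr (\<beta> * real k + b - 1) / Gamma (\<beta> * real k + b))"
  unfolding ml_kernel_term[OF assms(3)]
  by (intro summable_mult summable_power_div_Gamma assms)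

lemma mittag_leffler_eq_ml_kernel:
  assumes "t > 0"
  shows "mittag_leffler \<beta> (- \<mu> * t powr \<beta>) = ml_kernel \<beta> \<mu> 1 t"
  using assms unfolding mittag_leffler_def ml_kernel_def ml_kernel_term[OF assms]
  by (simp add: add.commute)

text \<open>Dropping the term k = 0 raises the index by \<beta>. As the kernel of index b + \<beta>
  is the fractional integral of order \<beta> of the one of index b, this is a linear Volterra
  equation with forcing t powr (b - 1) / Gamma b.\<close>

lemma ml_kernel_split:
  assumes "\<beta> > 0" "b > 0" "t > 0"
  shows "ml_kernel \<beta> \<mu> b t = t powr (b - 1) / Gamma b - \<mu> * ml_kernel \<beta> \<mu> (b + \<beta>) t"
proof -
  have "ml_kernel \<beta> \<mu> b t = t powr (b - 1) / Gamma b +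
     (\<Sum>k. (- \<mu>) ^ Suc k * t powr (\<beta> * real (Suc k) + b - 1) / Gamma (\<beta> * real (Suc k) + b))"
    unfolding ml_kernel_def using suminf_split_head[OF summable_ml_kernel[OF assms, of "-\<mu>"]]
    by simp
  also have "(\<Sum>k. (- \<mu>) ^ Suc k * t powr (\<beta> * real (Suc k) + b - 1) / Gamma (\<beta> * real (Suc k) + b))
    = (\<Sum>k. (- \<mu>) * ((- \<mu>) ^ k * t powr (\<beta> * real k + (b + \<beta>) - 1) / Gamma (\<beta> * real k + (b + \<beta>))))"
    by (intro suminf_cong) (simp add: algebra_simps)
  also have "\<dots> = (- \<mu>) * ml_kernel \<beta> \<mu> (b + \<beta>) t"
    unfolding ml_kernel_def using assms by (intro suminf_mult summable_ml_kernel) auto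
  finally show ?thesis by simp
qed

lemma ml_kernel_powser:
  assumes "\<beta> > 0" "b > 0" "t > 0"
  shows "ml_kernel \<beta> \<mu> b t
    = t powr (b - 1) * (\<Sum>k. (1 / Gamma (\<beta> * real k + b)) * (- \<mu> * t powr \<beta>) ^ k)"
  using suminf_mult[OF summable_power_div_Gamma[OF assms(1,2), of "- \<mu> * t powr \<beta>"], of "t powr (b - 1)"]
  unfolding ml_kernel_def ml_kernel_term[OF assms(3)] by simp

lemma isCont_ml_powser:
  fixes \<beta> b z :: real
  assumes "\<beta> > 0" "b > 0"
  shows "isCont (\<lambda>z. \<Sum>k. (1 / Gamma (\<beta> * real k + b)) * z ^ k) z"
  by (rule isCont_powser_converges_everywhere) (use summable_power_div_Gamma[OF assms] in simp)

text \<open>Once the factor t powr (b - 1), singular for b < 1, is split off, an everywhere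
  convergent power series in - \<mu> * t powr \<beta> remains, with value 1 / Gamma b > 0 at 0. This
  starts the first-zero argument for index \<beta>.\<close>

lemma ml_kernel_pos_near_0:
  assumes "\<beta> > 0" "b > 0"
  obtains d where "d > 0" "\<And>t. 0 < t \<Longrightarrow> t < d \<Longrightarrow> ml_kernel \<beta> \<mu> b t > 0"
proof -
  let ?E = "\<lambda>z. \<Sum>k. (1 / Gamma (\<beta> * real k + b)) * z ^ k"
  have "((\<lambda>t::real. t powr \<beta>) \<longlongrightarrow> 0) (at_right 0)"
    using assms by real_asymp
  from tendsto_mult_right_zero[OF this, of "- \<mu>"]
  have "((\<lambda>t. ?E (- \<mu> * t powr \<beta>)) \<longlongrightarrow> ?E 0) (at_right 0)"
    by (intro isCont_tendsto_compose[OF isCont_ml_powser] assms) simp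
  moreover have "?E 0 = 1 / Gamma b"
    using powser_zero[of "\<lambda>k. 1 / Gamma (\<beta> * real k + b)"] by simp
  moreover have "1 / Gamma b > 0" using assms by simp
  ultimately have "eventually (\<lambda>t. ?E (- \<mu> * t powr \<beta>) > 0) (at_right 0)"
    using order_tendstoD(1)[of "\<lambda>t. ?E (- \<mu> * t powr \<beta>)" "?E 0" "at_right 0" 0] by simp
  then obtain d where "d > 0" "\<And>t. 0 < t \<Longrightarrow> t < d \<Longrightarrow> ?E (- \<mu> * t powr \<beta>) > 0"
    unfolding eventually_at_right_field by auto
  then show ?thesis using that ml_kernel_powser[OF assms] by simp
qed

lemma continuous_on_ml_kernel:
  assumes "\<beta> > 0" "b > 0"
  shows "continuous_on {0<..} (ml_kernel \<beta> \<mu> b)"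
proof -
  let ?E = "\<lambda>z. \<Sum>k. (1 / Gamma (\<beta> * real k + b)) * z ^ k"
  have E: "continuous_on UNIV ?E"
    using isCont_ml_powser[OF assms] by (simp add: continuous_on_eq_continuous_at)
  have "continuous_on {0<..} (\<lambda>t. t powr (b - 1) * ?E (- \<mu> * t powr \<beta>))"
    by (intro continuous_intros continuous_on_compose2[OF E]) auto
  moreover have "ml_kernel \<beta> \<mu> b t = t powr (b - 1) * ?E (- \<mu> * t powr \<beta>)" if "t \<in> {0<..}" for t
    using that assms by (intro ml_kernel_powser) auto
  ultimately show ?thesis by (rule continuous_on_eq[OF _ sym])
qed

text \<open>Termwise integration with the Beta convolution. The majorant is the same series with
  |\<mu>| in place of - \<mu>: its terms are nonnegative and its integrals are summable by the same
  formula, which is why \<open>f\<close>, \<open>sm\<close> and \<open>sums\<close> keep c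
  general.\<close>

lemma has_bochner_integral_ml_kernel:
  fixes t :: real
  assumes "\<beta> > 0" "a > 0" "b > 0" "t > 0"
  shows "has_bochner_integral lborel
    (\<lambda>s. indicator {0..t} s * ((t - s) powr (a - 1) * ml_kernel \<beta> \<mu> b s))
    (Gamma a * ml_kernel \<beta> \<mu> (a + b) t)"
proof -
  let ?G = "\<lambda>k. Gamma (\<beta> * real k + b)"
  let ?f = "\<lambda>c k s. c ^ k / ?G k *
     (indicator {0..t} s * ((t - s) powr (a - 1) * s powr (\<beta> * real k + b - 1)))"
  let ?v = "\<lambda>c k. Gamma a * (c ^ k * t powr (\<beta> * real k + (a + b) - 1) / Gamma (\<beta> * real k + (a + b)))"
  have Gpos: "?G k > 0" for k using assms by (intro Gamma_real_pos add_nonneg_pos) auto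
  have f: "has_bochner_integral lborel (?f c k) (?v c k)" for c k
  proof -
    have "has_bochner_integral lborel (?f c k)
      (c ^ k / ?G k * (Gamma a * ?G k / Gamma (a + (\<beta> * real k + b)) * t powr (a + (\<beta> * real k + b) - 1)))"
      using assms by (intro has_bochner_integral_mult_right has_bochner_integral_Beta_convolution add_nonneg_pos) auto
    also have "(c ^ k / ?G k * (Gamma a * ?G k / Gamma (a + (\<beta> * real k + b)) * t powr (a + (\<beta> * real k + b) - 1)))
       = ?v c k" using Gpos[of k] by (simp add: algebra_simps)
    finally show ?thesis .
  qed
  have sm: "summable (\<lambda>k. ?v c k)" for c
    using assms by (intro summable_mult summable_ml_kernel) auto
  have nf: "norm (?f (-\<mu>) k s) = ?f \<bar>\<mu>\<bar> k s" for k s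
    using less_imp_le[OF Gpos[of k]] by (simp add: abs_mult power_abs)
  have 1: "integrable lborel (?f (-\<mu>) k)" for k using f has_bochner_integral_iff by blast
  have sums: "(\<lambda>k. ?f c k s) sums (indicator {0..t} s * ((t - s) powr (a - 1) *
      (\<Sum>k. c ^ k * s powr (\<beta> * real k + b - 1) / ?G k)))" for c s
  proof (cases "s > 0")
    case True
    have "(\<lambda>k. indicator {0..t} s * ((t - s) powr (a - 1) * (c ^ k * s powr (\<beta> * real k + b - 1) / ?G k)))
      sums (indicator {0..t} s * ((t - s) powr (a - 1) *
      (\<Sum>k. c ^ k * s powr (\<beta> * real k + b - 1) / ?G k)))"
      using assms True by (intro sums_mult summable_sums summable_ml_kernel)
    then show ?thesis by (simp add: mult_ac)
  next
    \<comment> \<open>For s = 0 every term vanishes because 0 powr c = 0; for s < 0 the indicator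
      does.\<close>
    case False
    then show ?thesis by (cases "s = 0") auto
  qed
  have 2: "AE s in lborel. summable (\<lambda>k. norm (?f (-\<mu>) k s))"
    unfolding nf using sums by (auto simp: summable_def)
  have "(\<integral>s. norm (?f (-\<mu>) k s) \<partial>lborel) = ?v \<bar>\<mu>\<bar> k" for k
    unfolding nf by (rule has_bochner_integral_integral_eq[OF f])
  then have 3: "summable (\<lambda>k. \<integral>s. norm (?f (-\<mu>) k s) \<partial>lborel)" using sm[of "\<bar>\<mu>\<bar>"] by simp
  have "has_bochner_integral lborel (\<lambda>s. \<Sum>k. ?f (-\<mu>) k s) (\<Sum>k. ?v (-\<mu>) k)"
    using integrable_suminf[OF 1 2 3] integral_suminf[OF 1 2 3] has_bochner_integral_integral_eq[OF f]
    by (simp add: has_bochner_integral_iff)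
  also have "(\<lambda>s. \<Sum>k. ?f (-\<mu>) k s) = (\<lambda>s. indicator {0..t} s * ((t - s) powr (a - 1) * ml_kernel \<beta> \<mu> b s))"
    unfolding ml_kernel_def using sums_unique[OF sums] by (auto simp: fun_eq_iff)
  also have "(\<Sum>k. ?v (-\<mu>) k) = Gamma a * ml_kernel \<beta> \<mu> (a + b) t"
    unfolding ml_kernel_def using assms by (intro suminf_mult summable_ml_kernel) auto
  finally show ?thesis .
qed


lemma Gamma_real_plus1: "Gamma (a + 1) = a * Gamma a" if "a > (0::real)"
  by (rule Gamma_plus1) (use that in \<open>auto elim!: nonpos_Ints_cases\<close>)

lemma has_bochner_integral_powr_left:
  fixes a t u :: real
  assumes "a > 0" "t < u"
  shows "has_bochner_integral lborel (\<lambda>s. indicator {t..u} s * (u - s) powr (a - 1)) ((u - t) powr a / a)"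
proof -
  have "has_bochner_integral lborel (\<lambda>s. indicator {0..u - t} s * ((u - t - s) powr (a - 1) * s powr (1 - 1)))
     (Gamma a * Gamma 1 / Gamma (a + 1) * (u - t) powr (a + 1 - 1))"
    using assms by (intro has_bochner_integral_Beta_convolution) auto
  also have "Gamma a * Gamma 1 / Gamma (a + 1) * (u - t) powr (a + 1 - 1) = (u - t) powr a / a"
    using less_imp_neq[OF Gamma_real_pos[OF assms(1)]] by (simp add: Gamma_real_plus1[OF assms(1)])
  finally have *: "has_bochner_integral lborel
     (\<lambda>s. indicator {0..u - t} s * ((u - t - s) powr (a - 1) * s powr (1 - 1))) ((u - t) powr a / a)" .
  have "has_bochner_integral lborel (\<lambda>s. indicator {t..u} (t + 1 * s) * (u - (t + 1 * s)) powr (a - 1))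
    ((u - t) powr a / a)"
  \<comment> \<open>At s = 0 the factor s powr 0 is 0 instead of 1, so the two integrands agree only
    off a null set.\<close>
  proof (rule has_bochner_integralI_AE[OF *])
    show "AE s in lborel. indicator {0..u - t} s * ((u - t - s) powr (a - 1) * s powr (1 - 1))
      = indicator {t..u} (t + 1 * s) * (u - (t + 1 * s)) powr (a - 1)"
      using AE_lborel_singleton[of 0] by eventually_elim (auto simp: indicator_def algebra_simps)
  qed measurable
  then show ?thesis
    by (subst lborel_has_bochner_integral_real_affine_iff[of 1 _ _ t]) auto
qed

text \<open>For b = 1 this is a convention and not the limit, which is 1. Hence the kernel is
  identified with the Mittag-Leffler function for t > 0 only; integrals do not see the
  point.\<close>

lemma ml_kernel_0 [simp]: "ml_kernel \<beta> \<mu> b 0 = 0"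
  by (simp add: ml_kernel_def)

text \<open>At a first zero \<open>t0\<close>, compare the Volterra equation with the one at a nearby maximum \<open>t < t0\<close>;
  the kernel \<open>s powr (\<beta> - 1)\<close> being log-convex, the past enters both in a comparable way.\<close>

lemma ml_kernel_pos:
  fixes t :: real
  assumes b: "0 < \<beta>" "\<beta> < 1" and "\<mu> \<ge> 0" "t > 0"
  shows "ml_kernel \<beta> \<mu> \<beta> t > 0"
proof (rule ccontr)
  let ?h = "ml_kernel \<beta> \<mu> \<beta>"
  let ?h2 = "ml_kernel \<beta> \<mu> (\<beta> + \<beta>)"
  assume neg: "\<not> ?h t > 0"
  obtain d where d: "d > 0" "\<And>t. 0 < t \<Longrightarrow> t < d \<Longrightarrow> ?h t > 0"
    using ml_kernel_pos_near_0[OF b(1) b(1)] by blast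
  have cont: "continuous_on {a..c} ?h" if "a > 0" for a c
    by (rule continuous_on_subset[OF continuous_on_ml_kernel[OF b(1) b(1)]]) (use that in auto)
  \<comment> \<open>Starting at d/2 keeps K compact inside (0,\<infinity>) and loses nothing, since
    h > 0 on (0,d).\<close>
  define K where "K = {s \<in> {d/2..t}. ?h s \<le> 0}"
  have td: "t \<ge> d" using d(2)[OF \<open>t > 0\<close>] neg by (meson not_le)
  have "compact K" unfolding K_def compact_eq_bounded_closed
  proof
    show "bounded {s \<in> {d / 2..t}. ?h s \<le> 0}"
      by (rule bounded_subset[OF bounded_closed_interval[of "d/2" t]]) auto
    show "closed {s \<in> {d / 2..t}. ?h s \<le> 0}"
      using d by (intro continuous_on_closed_Collect_le cont continuous_on_const) auto
  qed
  moreover have "t \<in> K" using neg td d by (auto simp: K_def)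
  ultimately obtain t0 where t0: "t0 \<in> K" "\<And>s. s \<in> K \<Longrightarrow> t0 \<le> s"
    using compact_attains_inf[of K] by blast
  have t0pos: "t0 > 0" and ht0: "?h t0 \<le> 0" using t0 d by (auto simp: K_def)
  have hpos: "?h s > 0" if "0 < s" "s < t0" for s
  proof (rule ccontr)
    assume "\<not> ?h s > 0"
    moreover have "s \<ge> d/2" using d that calculation by (smt (verit) field_sum_of_halves)
    moreover have "s \<le> t" using that t0 by (auto simp: K_def)
    ultimately have "s \<in> K" by (auto simp: K_def)
    then show False using t0(2) that by force
  qed
  \<comment> \<open>On a window of length \<eta> the memory kernel times \<mu> has mass \<mu>
    \<eta>^\<beta> / Gamma(\<beta>+1) < 1/2.\<close>
  define \<eta> where "\<eta> = (Gamma (\<beta> + 1) / (2 * (\<mu> + 1))) powr (1 / \<beta>)"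
  have Gp: "Gamma \<beta> > 0" "Gamma (\<beta> + 1) > 0" using b by (auto intro: Gamma_real_pos)
  have eta: "\<eta> > 0" "\<eta> powr \<beta> = Gamma (\<beta> + 1) / (2 * (\<mu> + 1))"
    using b assms Gp less_imp_neq[OF Gp(2)] by (auto simp: \<eta>_def powr_powr)
  \<comment> \<open>The bound t0 / 2 gives t0 / u <= 2 and hence \<rho> >= 1/2 below, which beats
    the loss on the window.\<close>
  define t1 where "t1 = max (t0 / 2) (t0 - \<eta>)"
  have t1: "0 < t1" "t1 < t0" "t0 \<le> 2 * t1" "t0 - t1 \<le> \<eta>"
    using t0pos eta(1) by (auto simp: t1_def max_def)
  obtain u where u: "u \<in> {t1..t0}" "\<And>s. s \<in> {t1..t0} \<Longrightarrow> ?h s \<le> ?h u"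
    using continuous_attains_sup[of "{t1..t0}" ?h] cont[OF t1(1)] t1 by auto
  have hu: "?h u > 0" using u(2)[of t1] hpos[OF t1(1,2)] t1 by auto
  then have ut: "0 < u" "u < t0" "t0 \<le> 2 * u" "t0 - u \<le> \<eta>"
    using u ht0 t1 by (auto simp: less_le)
  \<comment> \<open>The ratio of the forcing terms of the Volterra equation at t0 and at u. By t0 (u
    - s) <= u (t0 - s) it also bounds the ratio of the two kernels at every past time s < u. So
    h(t0) is at least \<rho> h(u) minus the contribution of [u,t0], where h <= h(u).\<close>
  define \<rho> where "\<rho> = (t0 / u) powr (\<beta> - 1)"
  have "Gamma \<beta> * ?h2 t0 \<le> \<rho> * (Gamma \<beta> * ?h2 u) + ?h u * ((t0 - u) powr \<beta> / \<beta>)"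
  proof -
    let ?f = "\<lambda>r s. indicator {0..r} s * ((r - s) powr (\<beta> - 1) * ?h s)"
    let ?g = "\<lambda>s. indicator {u..t0} s * (t0 - s) powr (\<beta> - 1)"
    have f: "has_bochner_integral lborel (?f t0) (Gamma \<beta> * ?h2 t0)"
      using b t0pos by (intro has_bochner_integral_ml_kernel) auto
    have r: "has_bochner_integral lborel (\<lambda>s. \<rho> * ?f u s + ?h u * ?g s)
      (\<rho> * (Gamma \<beta> * ?h2 u) + ?h u * ((t0 - u) powr \<beta> / \<beta>))"
      using b ut by (intro has_bochner_integral_add has_bochner_integral_mult_right
        has_bochner_integral_ml_kernel has_bochner_integral_powr_left) auto
    have "?f t0 s \<le> \<rho> * ?f u s + ?h u * ?g s" for s
    proof -
      consider "s < 0 \<or> s > t0" | "s = 0" | "0 < s" "s < u" | "s = u" | "u < s" "s \<le> t0" by force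
      then show ?thesis
      proof cases
        case 3
        have "t0 * (u - s) \<le> u * (t0 - s)" using 3 ut by (simp add: algebra_simps)
        then have "t0 / u * (u - s) \<le> t0 - s" using ut by (simp add: field_simps)
        moreover have "t0 / u * (u - s) > 0" using 3 ut by auto
        ultimately have "(t0 - s) powr (\<beta> - 1) \<le> (t0 / u * (u - s)) powr (\<beta> - 1)"
          using b by (intro powr_mono2') auto
        also have "\<dots> = \<rho> * (u - s) powr (\<beta> - 1)" by (subst powr_mult) (use ut 3 in \<open>auto simp: \<rho>_def\<close>)
        finally have "(t0 - s) powr (\<beta> - 1) * ?h s \<le> \<rho> * (u - s) powr (\<beta> - 1) * ?h s"
          using hpos[of s] 3 ut by (intro mult_right_mono) auto
        then show ?thesis using 3 ut by (simp add: indicator_def)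
      next
        case 5
        then have "?h s \<le> ?h u" using u by auto
        then have "(t0 - s) powr (\<beta> - 1) * ?h s \<le> (t0 - s) powr (\<beta> - 1) * ?h u"
          by (intro mult_left_mono) auto
        then show ?thesis using 5 ut by (simp add: indicator_def mult_ac)
      qed (use ut in \<open>auto simp: indicator_def mult_ac\<close>)
    qed
    then have "integral\<^sup>L lborel (?f t0) \<le> integral\<^sup>L lborel (\<lambda>s. \<rho> * ?f u s + ?h u * ?g s)"
      using f r by (intro integral_mono) (auto simp: has_bochner_integral_iff)
    then show ?thesis
      unfolding has_bochner_integral_integral_eq[OF f] has_bochner_integral_integral_eq[OF r] .
  qed
  then have "Gamma \<beta> * ?h2 t0 / Gamma \<beta> \<le> (\<rho> * (Gamma \<beta> * ?h2 u) + ?h u * ((t0 - u) powr \<beta> / \<beta>)) / Gamma \<beta>"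
    using Gp by (intro divide_right_mono) auto
  then have le: "?h2 t0 \<le> \<rho> * ?h2 u + ?h u * ((t0 - u) powr \<beta> / Gamma (\<beta> + 1))"
    using Gp b by (simp add: Gamma_real_plus1 add_divide_distrib mult.commute)
  have "\<mu> * ((t0 - u) powr \<beta> / Gamma (\<beta> + 1)) \<le> \<mu> * (\<eta> powr \<beta> / Gamma (\<beta> + 1))"
    using b assms Gp ut by (intro mult_left_mono divide_right_mono powr_mono2) auto
  also have "\<dots> < 1 / 2"
  proof -
    have "\<mu> * (\<eta> powr \<beta> / Gamma (\<beta> + 1)) = \<mu> / (2 * (\<mu> + 1))"
      unfolding eta using less_imp_neq[OF Gp(2)] by simp
    also have "\<dots> < 1 / 2" using assms by (simp add: field_simps)
    finally show ?thesis .
  qed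
  finally have small: "\<mu> * ((t0 - u) powr \<beta> / Gamma (\<beta> + 1)) < 1 / 2" .
  have "(1::real) / 2 = 2 powr (- 1)" by (simp add: powr_minus)
  also have "\<dots> \<le> 2 powr (\<beta> - 1)" using b by (intro powr_mono) auto
  also have "\<dots> \<le> \<rho>" unfolding \<rho>_def using b ut by (intro powr_mono2') (auto simp: field_simps)
  finally have rho: "1 / 2 \<le> \<rho>" .
  have rt: "\<rho> * u powr (\<beta> - 1) = t0 powr (\<beta> - 1)"
    unfolding \<rho>_def using ut t0pos by (simp add: powr_mult[symmetric])
  have "0 < ?h u * (\<rho> - \<mu> * ((t0 - u) powr \<beta> / Gamma (\<beta> + 1)))"
    using rho small by (intro mult_pos_pos hu) linarith
  also have "\<dots> = \<rho> * ?h u - ?h u * (\<mu> * ((t0 - u) powr \<beta> / Gamma (\<beta> + 1)))"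
    by (simp add: algebra_simps)
  also have "?h u = u powr (\<beta> - 1) / Gamma \<beta> - \<mu> * ?h2 u"
    using b ut by (intro ml_kernel_split) auto
  also have "\<rho> * (u powr (\<beta> - 1) / Gamma \<beta> - \<mu> * ?h2 u)
      - (u powr (\<beta> - 1) / Gamma \<beta> - \<mu> * ?h2 u) * (\<mu> * ((t0 - u) powr \<beta> / Gamma (\<beta> + 1)))
    = t0 powr (\<beta> - 1) / Gamma \<beta>
      - \<mu> * (\<rho> * ?h2 u + (u powr (\<beta> - 1) / Gamma \<beta> - \<mu> * ?h2 u) * ((t0 - u) powr \<beta> / Gamma (\<beta> + 1)))"
    unfolding rt[symmetric] by (simp add: algebra_simps)
  also have "u powr (\<beta> - 1) / Gamma \<beta> - \<mu> * ?h2 u = ?h u"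
    using b ut by (intro ml_kernel_split[symmetric]) auto
  also have "t0 powr (\<beta> - 1) / Gamma \<beta> - \<mu> * (\<rho> * ?h2 u + ?h u * ((t0 - u) powr \<beta> / Gamma (\<beta> + 1)))
    \<le> t0 powr (\<beta> - 1) / Gamma \<beta> - \<mu> * ?h2 t0"
    using le assms by (intro diff_left_mono mult_left_mono) auto
  also have "\<dots> = ?h t0"
    using b t0pos by (intro ml_kernel_split[symmetric]) auto
  finally show False using ht0 by simp
qed

section \<open>Monotonicity and two-sided bounds, from positivity of the kernel of index
  \<beta>\<close>

context
  fixes \<beta> \<mu> :: real
  assumes b: "0 < \<beta>" "\<beta> < 1" and mu: "\<mu> \<ge> 0"
begin

lemma ml_kernel_nonneg: "t \<ge> 0 \<Longrightarrow> ml_kernel \<beta> \<mu> \<beta> t \<ge> 0"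
  using ml_kernel_pos[OF b mu, of t] by (cases "t = 0") auto

text \<open>For a = 1 the fractional integral is the plain integral over [0,r], here of a
  nonnegative function.\<close>

lemma ml_kernel_1_mono:
  assumes "0 < s" "s \<le> t"
  shows "ml_kernel \<beta> \<mu> (1 + \<beta>) s \<le> ml_kernel \<beta> \<mu> (1 + \<beta>) t"
proof -
  let ?f = "\<lambda>r s. indicator {0..r} s * ((r - s) powr (1 - 1) * ml_kernel \<beta> \<mu> \<beta> s)"
  have f: "has_bochner_integral lborel (?f r) (Gamma 1 * ml_kernel \<beta> \<mu> (1 + \<beta>) r)" if "r > 0" for r
    using b that by (intro has_bochner_integral_ml_kernel) auto
  have "integral\<^sup>L lborel (?f s) \<le> integral\<^sup>L lborel (?f t)"
    using f[of s] f[of t] assms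
    by (intro integral_mono) (auto simp: has_bochner_integral_iff indicator_def ml_kernel_nonneg)
  then show ?thesis
    using f[of s] f[of t] assms by (auto simp: has_bochner_integral_iff)
qed

text \<open>The splitting at b = 1: a constant minus \<mu> times the integral of the positive kernel
  of index \<beta>. This turns positivity of that kernel into monotonicity of the function
  itself.\<close>

lemma mittag_leffler_eq:
  assumes "t > 0"
  shows "mittag_leffler \<beta> (- \<mu> * t powr \<beta>) = 1 - \<mu> * ml_kernel \<beta> \<mu> (1 + \<beta>) t"
  unfolding mittag_leffler_eq_ml_kernel[OF assms]
  using ml_kernel_split[of \<beta> 1 t \<mu>] b assms by simp

lemma mittag_leffler_antimono:
  assumes "0 < s" "s \<le> t"
  shows "mittag_leffler \<beta> (- \<mu> * t powr \<beta>) \<le> mittag_leffler \<beta> (- \<mu> * s powr \<beta>)"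
  using assms mu mult_left_mono[OF ml_kernel_1_mono[OF assms] mu]
  by (simp add: mittag_leffler_eq[unfolded mult_minus_left])

text \<open>The left-hand side is \<open>\<mu>\<close> times the plain integral of the kernel of index \<open>\<beta>\<close> over \<open>[0,t]\<close>, while
  the function itself is its integral against \<open>(t - s) powr (- \<beta>) / Gamma (1 - \<beta>)\<close>, a weight that is
  smallest at \<open>s = 0\<close>.\<close>

lemma mittag_leffler_lower_aux:
  assumes "t > 0"
  shows "1 - mittag_leffler \<beta> (- \<mu> * t powr \<beta>)
    \<le> Gamma (1 - \<beta>) * \<mu> * t powr \<beta> * mittag_leffler \<beta> (- \<mu> * t powr \<beta>)"
proof -
  let ?f = "\<lambda>a s. indicator {0..t} s * ((t - s) powr (a - 1) * ml_kernel \<beta> \<mu> \<beta> s)"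
  have f: "has_bochner_integral lborel (?f a) (Gamma a * ml_kernel \<beta> \<mu> (a + \<beta>) t)" if "a > 0" for a
    using b that assms by (intro has_bochner_integral_ml_kernel) auto
  have "t powr (- \<beta>) * ?f 1 s \<le> ?f (1 - \<beta>) s" for s
  proof (cases "0 \<le> s \<and> s < t")
    case True
    then have "t powr (- \<beta>) * ml_kernel \<beta> \<mu> \<beta> s \<le> (t - s) powr (- \<beta>) * ml_kernel \<beta> \<mu> \<beta> s"
      using b by (intro mult_right_mono ml_kernel_nonneg powr_mono2') auto
    then show ?thesis using True by (simp add: indicator_def)
  qed (auto simp: indicator_def)
  then have "integral\<^sup>L lborel (\<lambda>s. t powr (- \<beta>) * ?f 1 s) \<le> integral\<^sup>L lborel (?f (1 - \<beta>))"
    using f[of 1] f[of "1 - \<beta>"] b by (intro integral_mono) (auto simp: has_bochner_integral_iff)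
  then have "t powr (- \<beta>) * ml_kernel \<beta> \<mu> (1 + \<beta>) t \<le> Gamma (1 - \<beta>) * ml_kernel \<beta> \<mu> 1 t"
    using f[of 1] f[of "1 - \<beta>"] b by (auto simp: has_bochner_integral_iff)
  then have "\<mu> * t powr \<beta> * (t powr (- \<beta>) * ml_kernel \<beta> \<mu> (1 + \<beta>) t)
      \<le> \<mu> * t powr \<beta> * (Gamma (1 - \<beta>) * ml_kernel \<beta> \<mu> 1 t)"
    using mu by (intro mult_left_mono) auto
  also have "\<mu> * t powr \<beta> * (t powr (- \<beta>) * ml_kernel \<beta> \<mu> (1 + \<beta>) t) = \<mu> * ml_kernel \<beta> \<mu> (1 + \<beta>) t"
    using assms by (simp add: powr_minus)
  finally show ?thesis
    using mittag_leffler_eq[OF assms] mittag_leffler_eq_ml_kernel[OF assms, of \<beta> \<mu>] by (simp add: mult_ac)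
qed

text \<open>A nonpositive value would make the left-hand side of the preceding estimate at least 1
  and its right-hand side at most 0.\<close>

lemma mittag_leffler_pos:
  assumes "t > 0"
  shows "mittag_leffler \<beta> (- \<mu> * t powr \<beta>) > 0"
proof (rule ccontr)
  assume neg: "\<not> ?thesis"
  have "Gamma (1 - \<beta>) * \<mu> * t powr \<beta> \<ge> 0" using b mu by simp
  then have "Gamma (1 - \<beta>) * \<mu> * t powr \<beta> * mittag_leffler \<beta> (- \<mu> * t powr \<beta>) \<le> 0"
    using neg by (intro mult_nonneg_nonpos) auto
  then show False using mittag_leffler_lower_aux[OF assms] neg by simp
qed

lemma mittag_leffler_lower:
  assumes "t > 0"
  shows "1 / (1 + Gamma (1 - \<beta>) * \<mu> * t powr \<beta>) \<le> mittag_leffler \<beta> (- \<mu> * t powr \<beta>)"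
proof -
  have "Gamma (1 - \<beta>) * \<mu> * t powr \<beta> \<ge> 0" using b mu by simp
  then show ?thesis
    using mittag_leffler_lower_aux[OF assms] by (simp add: divide_le_eq algebra_simps)
qed

text \<open>By monotonicity the fractional integral of order \<beta> of the function is at least its
  value at t times t^\<beta> / Gamma(1+\<beta>); this is inserted into the Volterra equation for
  index 1. The decay in \<mu> is what makes the eigenfunction series converge.\<close>

lemma mittag_leffler_upper:
  assumes "t > 0"
  shows "mittag_leffler \<beta> (- \<mu> * t powr \<beta>) * (1 + \<mu> * t powr \<beta> / Gamma (1 + \<beta>)) \<le> 1"
proof -
  let ?e = "ml_kernel \<beta> \<mu> 1"
  let ?f = "\<lambda>s. indicator {0..t} s * ((t - s) powr (\<beta> - 1) * ?e s)"
  let ?g = "\<lambda>s. indicator {0..t} s * ((t - s) powr (\<beta> - 1) * s powr (1 - 1))"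
  have f: "has_bochner_integral lborel ?f (Gamma \<beta> * ml_kernel \<beta> \<mu> (\<beta> + 1) t)"
    using b assms by (intro has_bochner_integral_ml_kernel) auto
  have g: "has_bochner_integral lborel ?g (Gamma \<beta> * Gamma 1 / Gamma (\<beta> + 1) * t powr (\<beta> + 1 - 1))"
    using b assms by (intro has_bochner_integral_Beta_convolution) auto
  have "?e t * ?g s \<le> ?f s" for s
  proof (cases "0 < s \<and> s \<le> t")
    case True
    then have "?e t \<le> ?e s"
      using mittag_leffler_antimono[of s t] assms by (simp add: mittag_leffler_eq_ml_kernel[symmetric])
    then have "(t - s) powr (\<beta> - 1) * ?e t \<le> (t - s) powr (\<beta> - 1) * ?e s" by (intro mult_left_mono) auto
    then show ?thesis using True by (simp add: indicator_def mult_ac)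
  next
    case False
    then show ?thesis by (cases "s = 0") (auto simp: indicator_def)
  qed
  then have "integral\<^sup>L lborel (\<lambda>s. ?e t * ?g s) \<le> integral\<^sup>L lborel ?f"
    using f g by (intro integral_mono) (auto simp: has_bochner_integral_iff)
  then have "?e t * (Gamma \<beta> * t powr \<beta> / Gamma (\<beta> + 1)) \<le> Gamma \<beta> * ml_kernel \<beta> \<mu> (\<beta> + 1) t"
    using f g by (simp add: has_bochner_integral_iff)
  then have "Gamma \<beta> * (?e t * (t powr \<beta> / Gamma (\<beta> + 1))) \<le> Gamma \<beta> * ml_kernel \<beta> \<mu> (\<beta> + 1) t"
    by (simp add: mult_ac)
  then have "?e t * (t powr \<beta> / Gamma (\<beta> + 1)) \<le> ml_kernel \<beta> \<mu> (\<beta> + 1) t"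
    by (rule mult_left_le_imp_le[OF _ Gamma_real_pos[OF b(1)]])
  then have "\<mu> * (?e t * (t powr \<beta> / Gamma (\<beta> + 1))) \<le> \<mu> * ml_kernel \<beta> \<mu> (\<beta> + 1) t"
    using mu by (intro mult_left_mono)
  then show ?thesis
    using mittag_leffler_eq[OF assms] mittag_leffler_eq_ml_kernel[OF assms, of \<beta> \<mu>]
    by (simp add: algebra_simps)
qed

end

section \<open>Eigenfunction expansion of the kernel\<close>

text \<open>The series is dominated by B |w| times the sum of |a n|. The measure is general because
  w is \<phi> on the Borel sets of [0,L] in one use and u0 on the completed measure in the
  other.\<close>

lemma integral_mult_suminf:
  fixes f :: "nat \<Rightarrow> 'a \<Rightarrow> real" and w :: "'a \<Rightarrow> real"
  assumes w: "integrable M w" and a: "summable (\<lambda>n. \<bar>a n\<bar>)"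
    and [measurable]: "\<And>n. f n \<in> borel_measurable M" and bd: "\<And>n x. \<bar>f n x\<bar> \<le> B"
  shows "has_bochner_integral M (\<lambda>x. w x * (\<Sum>n. a n * f n x)) (\<Sum>n. a n * (\<integral>x. w x * f n x \<partial>M))"
proof -
  have [measurable]: "w \<in> borel_measurable M" using w by simp
  have bd': "norm (w x * (a n * f n x)) \<le> norm (\<bar>a n\<bar> * B * \<bar>w x\<bar>)" for n x
  proof -
    have "norm (w x * (a n * f n x)) = \<bar>a n\<bar> * \<bar>f n x\<bar> * \<bar>w x\<bar>" by (simp add: abs_mult)
    also have "\<dots> \<le> \<bar>a n\<bar> * B * \<bar>w x\<bar>" by (intro mult_right_mono mult_left_mono bd) auto
    finally show ?thesis by (simp add: abs_if split: if_splits)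
  qed
  have B: "B \<ge> 0" using bd[of 0 undefined] by simp
  have dom: "integrable M (\<lambda>x. \<bar>a n\<bar> * B * \<bar>w x\<bar>)" for n using w by simp
  have 1: "integrable M (\<lambda>x. w x * (a n * f n x))" for n
    by (rule Bochner_Integration.integrable_bound[OF dom[of n]]) (use bd' in \<open>measurable, blast\<close>)
  have sab: "summable (\<lambda>n. \<bar>a n\<bar> * B * c)" for c using a by (intro summable_mult2)
  have sn: "summable (\<lambda>n. norm (w x * (a n * f n x)))" for x
    by (rule summable_comparison_test[OF _ sab[of "\<bar>w x\<bar>"]]) (use bd'[of x] B in \<open>auto simp: abs_mult\<close>)
  have 3: "summable (\<lambda>n. \<integral>x. norm (w x * (a n * f n x)) \<partial>M)"
  proof (rule summable_comparison_test[OF _ sab[of "\<integral>x. \<bar>w x\<bar> \<partial>M"]], intro exI allI impI)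
    fix n
    have "(\<integral>x. norm (w x * (a n * f n x)) \<partial>M) \<le> (\<integral>x. \<bar>a n\<bar> * B * \<bar>w x\<bar> \<partial>M)"
    proof (rule integral_mono)
      show "norm (w x * (a n * f n x)) \<le> \<bar>a n\<bar> * B * \<bar>w x\<bar>" for x
        using bd'[of x n] B by (simp add: abs_mult)
    qed (use 1[of n] dom[of n] in simp_all)
    then show "norm (\<integral>x. norm (w x * (a n * f n x)) \<partial>M) \<le> \<bar>a n\<bar> * B * (\<integral>x. \<bar>w x\<bar> \<partial>M)"
      by (simp add: integral_nonneg_AE)
  qed
  have sf: "summable (\<lambda>n. a n * f n x)" for x
  proof (rule summable_comparison_test)
    show "\<exists>N. \<forall>n\<ge>N. norm (a n * f n x) \<le> \<bar>a n\<bar> * B"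
      using bd by (auto simp: abs_mult intro!: exI mult_left_mono)
  qed (intro summable_mult2 a)
  have "has_bochner_integral M (\<lambda>x. \<Sum>n. w x * (a n * f n x)) (\<Sum>n. \<integral>x. w x * (a n * f n x) \<partial>M)"
    using integrable_suminf[OF 1 _ 3] integral_suminf[OF 1 _ 3] sn
    by (simp add: has_bochner_integral_iff)
  moreover have "(\<Sum>n. w x * (a n * f n x)) = w x * (\<Sum>n. a n * f n x)" for x
    using sf by (rule suminf_mult)
  moreover have "(\<integral>x. w x * (a n * f n x) \<partial>M) = a n * (\<integral>x. w x * f n x \<partial>M)" for n
    by (subst integral_mult_right_zero[symmetric]) (simp add: mult_ac)
  ultimately show ?thesis by simp
qed

section \<open>The sine basis and its pairing with the first eigenfunction\<close>

lemma measurable_dir_eigenfun [measurable]: "dir_eigenfun L n \<in> borel_measurable borel"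
  unfolding dir_eigenfun_def by measurable

lemma dir_eigenfun_bound: "\<bar>dir_eigenfun L n x\<bar> \<le> sqrt (2 / L)" if "L > 0"
  using that mult_left_le[of "\<bar>sin (real n * pi * x / L)\<bar>" "sqrt (2 / L)"]
  by (simp add: dir_eigenfun_def abs_mult)

lemma dir_eigenfun_1_pos: "dir_eigenfun L 1 x > 0" if "0 < x" "x < L"
  using that by (auto simp: dir_eigenfun_def field_simps intro!: mult_pos_pos sin_gt_zero)

lemma dir_eigenfun_1_nonneg: "dir_eigenfun L 1 x \<ge> 0" if "0 \<le> x" "x \<le> L"
  using that by (cases "L = 0") (auto simp: dir_eigenfun_def field_simps intro!: mult_nonneg_nonneg sin_ge_zero)

lemma has_bochner_integral_cos:
  assumes "L > 0"
  shows "has_bochner_integral (restrict_space lborel {0..L}) (\<lambda>x. cos (real n * pi * x / L)) (if n = 0 then L else 0)"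
proof (cases "n = 0")
  case True
  have "has_bochner_integral lborel (\<lambda>x. 1 * indicator {0..L} x) (L - 0)"
    using assms by (intro has_bochner_integral_FTC_Icc_real derivative_intros) auto
  then show ?thesis using True by (simp add: has_bochner_integral_restrict_space)
next
  case False
  have "has_bochner_integral lborel (\<lambda>x. cos (real n * pi * x / L) * indicator {0..L} x)
    (sin (real n * pi * L / L) / (real n * pi / L) - sin (real n * pi * 0 / L) / (real n * pi / L))"
    using assms False by (intro has_bochner_integral_FTC_Icc_real) (auto intro!: derivative_eq_intros)
  then show ?thesis using False assms by (simp add: has_bochner_integral_restrict_space mult.commute)
qed

text \<open>2 sin t sin((n+1) t) = cos(n t) - cos((n+2) t), and over [0,L] only cos 0 has a nonzero
  integral. One factor is always the first eigenfunction because the weight selects that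
  mode.\<close>

lemma dir_eigenfun_orthonormal:
  assumes "L > 0"
  shows "has_bochner_integral (restrict_space lborel {0..L}) (\<lambda>x. dir_eigenfun L 1 x * dir_eigenfun L (Suc n) x)
    (if n = 0 then 1 else 0)"
proof -
  have "has_bochner_integral (restrict_space lborel {0..L})
     (\<lambda>x. 1 / L * (cos (real n * pi * x / L) - cos (real (n + 2) * pi * x / L)))
     (1 / L * ((if n = 0 then L else 0) - (if n + 2 = 0 then L else 0)))"
    using assms by (intro has_bochner_integral_mult_right has_bochner_integral_diff has_bochner_integral_cos)
  moreover have "1 / L * (cos (real n * pi * x / L) - cos (real (n + 2) * pi * x / L))
     = dir_eigenfun L 1 x * dir_eigenfun L (Suc n) x" for x
  proof -
    define t where "t = pi * x / L"
    have e: "real n * pi * x / L = real (Suc n) * t - t" "real (n + 2) * pi * x / L = real (Suc n) * t + t"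
      "real (Suc n) * pi * x / L = real (Suc n) * t" "real 1 * pi * x / L = t"
      by (simp_all add: t_def algebra_simps add_divide_distrib)
    have "dir_eigenfun L 1 x * dir_eigenfun L (Suc n) x = 2 / L * (sin t * sin (real (Suc n) * t))"
    proof -
      have "sqrt (2 / L) * sqrt (2 / L) = 2 / L" using assms by simp
      then show ?thesis unfolding dir_eigenfun_def e by (metis mult.assoc mult.left_commute)
    qed
    also have "\<dots> = 1 / L * (cos (real (Suc n) * t - t) - cos (real (Suc n) * t + t))"
      by (simp add: cos_add cos_diff)
    finally show ?thesis unfolding e by simp
  qed
  ultimately show ?thesis using assms by (cases "n = 0") auto
qed

lemma measurable_mittag_leffler [measurable]: "mittag_leffler \<beta> \<in> borel_measurable borel"
  unfolding mittag_leffler_def[abs_def] by measurable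

text \<open>\<open>suminf\<close> of measurable terms is measurable whether or not the series
  converges, so this covers all arguments, including the times t - s <= 0.\<close>

lemma measurable_G_D [measurable]:
  assumes [measurable]: "f \<in> borel_measurable M" "g \<in> borel_measurable M" "h \<in> borel_measurable M"
  shows "(\<lambda>p. G_D L \<beta> (f p) (g p) (h p)) \<in> borel_measurable M"
  unfolding G_D_def by measurable

locale dirichlet_kernel =
  fixes L \<beta> :: real
  assumes L: "L > 0" and b: "0 < \<beta>" "\<beta> < 1"
begin

abbreviation "X \<equiv> restrict_space lborel {0..L}"
abbreviation "\<phi> \<equiv> dir_eigenfun L 1"

text \<open>Indices are shifted by one: \<open>eig 0\<close> belongs to the first eigenvalue.\<close>

definition eig :: "nat \<Rightarrow> real \<Rightarrow> real" where
  "eig n t = mittag_leffler \<beta> (- dir_eigenval L (Suc n) * t powr \<beta>)"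

lemma dir_eigenval_pos: "dir_eigenval L (Suc n) > 0"
  using L by (simp add: dir_eigenval_def)

lemma eig_pos: "t > 0 \<Longrightarrow> eig n t > 0"
  unfolding eig_def using dir_eigenval_pos[of n] by (intro mittag_leffler_pos b) auto

lemma eig_antimono: "0 < s \<Longrightarrow> s \<le> t \<Longrightarrow> eig n t \<le> eig n s"
  unfolding eig_def using dir_eigenval_pos[of n] by (intro mittag_leffler_antimono b) auto

text \<open>The eigenvalues grow like n^2, so the upper bound of order 1 / (\<mu> t^\<beta>) gives a
  multiple of 1/n^2. The constant blows up as t tends to 0.\<close>

lemma summable_eig:
  assumes t: "t > 0"
  shows "summable (\<lambda>n. \<bar>eig n t\<bar>)"
proof (rule summable_comparison_test)
  let ?C = "Gamma (1 + \<beta>) / ((pi / L)\<^sup>2 / 2 * t powr \<beta>)"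
  have "norm \<bar>eig n t\<bar> \<le> ?C * inverse (real (Suc n) ^ 2)" for n
  proof -
    let ?\<mu> = "dir_eigenval L (Suc n)"
    have G: "Gamma (1 + \<beta>) > 0" using b by (intro Gamma_real_pos) auto
    have p: "?\<mu> * t powr \<beta> > 0" using t dir_eigenval_pos by simp
    have "eig n t * (?\<mu> * t powr \<beta> / Gamma (1 + \<beta>)) \<le> eig n t * (1 + ?\<mu> * t powr \<beta> / Gamma (1 + \<beta>))"
      using eig_pos[OF t, of n] by (intro mult_left_mono) auto
    also have "\<dots> \<le> 1"
      unfolding eig_def using dir_eigenval_pos[of n] by (intro mittag_leffler_upper b t) auto
    finally have "eig n t \<le> Gamma (1 + \<beta>) / (?\<mu> * t powr \<beta>)"
      using p G by (simp add: pos_le_divide_eq pos_divide_le_eq)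
    also have "\<dots> = ?C * inverse (real (Suc n) ^ 2)"
      using t L by (simp add: dir_eigenval_def power_mult_distrib power_divide divide_simps del: of_nat_Suc)
    finally show ?thesis using eig_pos[OF t, of n] by simp
  qed
  then show "\<exists>N. \<forall>n\<ge>N. norm \<bar>eig n t\<bar> \<le> ?C * inverse (real (Suc n) ^ 2)" by blast
  show "summable (\<lambda>n. ?C * inverse (real (Suc n) ^ 2))"
    using inverse_power_summable[of 2] summable_Suc_iff[of "\<lambda>n. inverse (real n ^ 2)"]
    by (intro summable_mult) simp
qed

lemma measurable_X: "f \<in> borel_measurable borel \<Longrightarrow> f \<in> borel_measurable X"
  by (rule measurable_restrict_space1) simp

lemma emeasure_X: "emeasure X (space X) = ennreal L"
  using L by (simp add: emeasure_restrict_space space_restrict_space)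

lemma finite_measure_X: "finite_measure X"
  by (rule finite_measureI) (unfold emeasure_X, simp)

lemma integrable_phi: "integrable X \<phi>"
proof -
  interpret finite_measure X by (rule finite_measure_X)
  show ?thesis
    by (rule integrable_const_bound[of _ "sqrt (2 / L)"])
      (use dir_eigenfun_bound[OF L] measurable_X[OF measurable_dir_eigenfun] in auto)
qed

lemma phi_integral_series:
  assumes "summable (\<lambda>n. \<bar>a n\<bar>)"
  shows "has_bochner_integral X (\<lambda>x. \<phi> x * (\<Sum>n. a n * dir_eigenfun L (Suc n) x)) (a 0)"
proof -
  have "has_bochner_integral X (\<lambda>x. \<phi> x * (\<Sum>n. a n * dir_eigenfun L (Suc n) x))
     (\<Sum>n. a n * (\<integral>x. \<phi> x * dir_eigenfun L (Suc n) x \<partial>X))"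
    by (rule integral_mult_suminf[OF integrable_phi assms measurable_X[OF measurable_dir_eigenfun] dir_eigenfun_bound[OF L]])
  also have "(\<Sum>n. a n * (\<integral>x. \<phi> x * dir_eigenfun L (Suc n) x \<partial>X)) = (\<Sum>n. if n = 0 then a n else 0)"
    using has_bochner_integral_integral_eq[OF dir_eigenfun_orthonormal[OF L]]
    by (intro suminf_cong) auto
  also have "\<dots> = a 0" by (subst suminf_finite[of "{0}"]) auto
  finally show ?thesis .
qed

lemma summable_eig_mult:
  assumes "t > 0" "\<And>n. \<bar>c n\<bar> \<le> C"
  shows "summable (\<lambda>n. \<bar>eig n t * c n\<bar>)"
proof (rule summable_comparison_test)
  show "\<exists>N. \<forall>n\<ge>N. norm \<bar>eig n t * c n\<bar> \<le> \<bar>eig n t\<bar> * C"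
    using assms(2) by (auto simp: abs_mult intro!: exI mult_left_mono)
qed (intro summable_mult2 summable_eig assms)

text \<open>Orthogonality removes every mode but the first. This is the reproducing property of
  \<phi> behind the choice of the weight.\<close>

lemma phi_integral_G_D:
  assumes "t > 0"
  shows "has_bochner_integral X (\<lambda>x. \<phi> x * G_D L \<beta> t x y) (eig 0 t * \<phi> y)"
proof -
  have "summable (\<lambda>n. \<bar>eig n t * dir_eigenfun L (Suc n) y\<bar>)"
    by (rule summable_eig_mult[OF assms dir_eigenfun_bound[OF L]])
  from phi_integral_series[OF this] show ?thesis
    unfolding G_D_def eig_def by (simp add: mult_ac)
qed

text \<open>The initial value lives on the completed measure, so it is moved into the coefficients;
  what remains is a sine series in x, from which Borel measurability in x can be read off.\<close>

lemma G_D_op_series: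
  assumes u0: "integrable (lebesgue_on {0..L}) u0" and t: "t > 0"
  shows "G_D_op L \<beta> u0 t x
    = (\<Sum>n. (eig n t * (\<integral>y. u0 y * dir_eigenfun L (Suc n) y \<partial>lebesgue_on {0..L})) * dir_eigenfun L (Suc n) x)"
proof -
  have "summable (\<lambda>n. \<bar>eig n t * dir_eigenfun L (Suc n) x\<bar>)"
    by (rule summable_eig_mult[OF t dir_eigenfun_bound[OF L]])
  moreover have "dir_eigenfun L (Suc n) \<in> borel_measurable (lebesgue_on {0..L})" for n
    by (rule measurable_restrict_space1, rule measurable_completion) simp
  ultimately have "has_bochner_integral (lebesgue_on {0..L})
      (\<lambda>y. u0 y * (\<Sum>n. (eig n t * dir_eigenfun L (Suc n) x) * dir_eigenfun L (Suc n) y))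
      (\<Sum>n. (eig n t * dir_eigenfun L (Suc n) x) * (\<integral>y. u0 y * dir_eigenfun L (Suc n) y \<partial>lebesgue_on {0..L}))"
    by (intro integral_mult_suminf[OF u0 _ _ dir_eigenfun_bound[OF L]])
  then show ?thesis
    unfolding G_D_op_def G_D_def eig_def by (simp add: mult_ac has_bochner_integral_iff)
qed

lemma
  assumes u0: "integrable (lebesgue_on {0..L}) u0" and t: "t > 0"
  shows phi_integral_G_D_op: "has_bochner_integral X (\<lambda>x. \<phi> x * G_D_op L \<beta> u0 t x)
      (eig 0 t * (\<integral>y. u0 y * \<phi> y \<partial>lebesgue_on {0..L}))"
    and measurable_G_D_op: "G_D_op L \<beta> u0 t \<in> borel_measurable borel"
proof -
  let ?c = "\<lambda>n. \<integral>y. u0 y * dir_eigenfun L (Suc n) y \<partial>lebesgue_on {0..L}"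
  have "\<bar>?c n\<bar> \<le> (\<integral>y. sqrt (2 / L) * \<bar>u0 y\<bar> \<partial>lebesgue_on {0..L})" for n
  proof -
    have "\<bar>?c n\<bar> \<le> (\<integral>y. \<bar>u0 y * dir_eigenfun L (Suc n) y\<bar> \<partial>lebesgue_on {0..L})"
      by (rule integral_abs_bound)
    also have "\<dots> \<le> (\<integral>y. sqrt (2 / L) * \<bar>u0 y\<bar> \<partial>lebesgue_on {0..L})"
      using u0 dir_eigenfun_bound[OF L]
      by (intro integral_mono') (auto simp: abs_mult mult.commute intro!: mult_left_mono)
    finally show ?thesis .
  qed
  then have "summable (\<lambda>n. \<bar>eig n t * ?c n\<bar>)" by (intro summable_eig_mult t)
  from phi_integral_series[OF this]
  show "has_bochner_integral X (\<lambda>x. \<phi> x * G_D_op L \<beta> u0 t x)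
      (eig 0 t * (\<integral>y. u0 y * \<phi> y \<partial>lebesgue_on {0..L}))"
    by (simp add: G_D_op_series[OF u0 t])
  show "G_D_op L \<beta> u0 t \<in> borel_measurable borel"
    unfolding G_D_op_series[OF u0 t, abs_def] by measurable
qed

text \<open>Cauchy-Schwarz against the constant 1, obtained from (f - a/L)^2 >= 0: the minorant 2
  (a/L) f - (a/L)^2 of f^2 integrates to a^2 / L. In this form f^2 may have infinite
  integral.\<close>

lemma power2_integral_le:
  assumes f: "has_bochner_integral X f a"
  shows "ennreal (a\<^sup>2 / L) \<le> (\<integral>\<^sup>+x. ennreal ((f x)\<^sup>2) \<partial>X)"
proof -
  interpret finite_measure X by (rule finite_measure_X)
  have mL: "measure X {0..L} = L" using emeasure_X L by (simp add: measure_def)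
  let ?m = "a / L"
  have g: "has_bochner_integral X (\<lambda>x. 2 * ?m * f x - ?m\<^sup>2) (2 * ?m * a - ?m\<^sup>2 * L)"
    by (intro has_bochner_integral_diff has_bochner_integral_mult_right f)
       (simp add: has_bochner_integral_iff mL mult.commute)
  have "2 * ?m * a - ?m\<^sup>2 * L = a\<^sup>2 / L" using L by (simp add: power2_eq_square field_simps)
  then have eq: "a\<^sup>2 / L = (\<integral>x. 2 * ?m * f x - ?m\<^sup>2 \<partial>X)"
    using has_bochner_integral_integral_eq[OF g] by simp
  have le: "2 * ?m * f x - ?m\<^sup>2 \<le> (f x)\<^sup>2" for x
    using zero_le_power2[of "f x - ?m"] by (simp add: power2_diff mult_ac)
  have "ennreal (a\<^sup>2 / L) \<le> (\<integral>\<^sup>+x. ennreal (2 * ?m * f x - ?m\<^sup>2) \<partial>X)"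
  proof -
    have gi: "integrable X (\<lambda>x. 2 * ?m * f x - ?m\<^sup>2)" using g by (simp add: has_bochner_integral_iff)
    \<comment> \<open>The Bochner integral is the positive part minus the negative part, and the
      latter is dropped. \<open>enn2real\<close> sends \<infinity> to 0, so going back to
      \<open>ennreal\<close> gives only an inequality.\<close>
    have "a\<^sup>2 / L \<le> enn2real (\<integral>\<^sup>+x. ennreal (2 * ?m * f x - ?m\<^sup>2) \<partial>X)"
      unfolding eq real_lebesgue_integral_def[OF gi] by simp
    then have "ennreal (a\<^sup>2 / L) \<le> ennreal (enn2real (\<integral>\<^sup>+x. ennreal (2 * ?m * f x - ?m\<^sup>2) \<partial>X))"
      by (rule ennreal_leI)
    also have "\<dots> \<le> (\<integral>\<^sup>+x. ennreal (2 * ?m * f x - ?m\<^sup>2) \<partial>X)"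
      by (simp add: ennreal_enn2real_if)
    finally show ?thesis .
  qed
  also have "\<dots> \<le> (\<integral>\<^sup>+x. ennreal ((f x)\<^sup>2) \<partial>X)"
    using le by (intro nn_integral_mono ennreal_leI) auto
  finally show ?thesis .
qed

lemma phi_power2_integral: "(\<integral>\<^sup>+x. ennreal ((\<phi> x)\<^sup>2) \<partial>X) = 1"
  using dir_eigenfun_orthonormal[OF L, of 0]
  by (subst nn_integral_eq_integral) (auto simp: has_bochner_integral_iff power2_eq_square)

lemma initial_mass_pos:
  assumes u0: "u0 \<in> borel_measurable (lebesgue_on {0..L})" "\<And>x. x \<in> {0..L} \<Longrightarrow> 0 \<le> u0 x"
    "bounded (u0 ` {0..L})" "emeasure lebesgue {x \<in> {0..L}. 0 < u0 x} > 0"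
  shows "integrable (lebesgue_on {0..L}) u0" "(\<integral>y. u0 y * \<phi> y \<partial>lebesgue_on {0..L}) > 0"
proof -
  have em: "emeasure (lebesgue_on {0..L}) {0..L} = ennreal L"
    using L by (subst emeasure_restrict_space) auto
  interpret Z: finite_measure "lebesgue_on {0..L}"
    by (rule finite_measureI) (use em in \<open>simp add: space_restrict_space\<close>)
  obtain K where K: "\<And>x. x \<in> {0..L} \<Longrightarrow> \<bar>u0 x\<bar> \<le> K" using u0(3) unfolding bounded_iff by (metis imageI real_norm_def)
  show ui: "integrable (lebesgue_on {0..L}) u0"
  proof (rule Z.integrable_const_bound[of _ K])
    show "AE x in lebesgue_on {0..L}. norm (u0 x) \<le> K"
      by (rule AE_I2) (use K in \<open>simp add: space_restrict_space\<close>)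
  qed (rule u0(1))
  have ph: "\<phi> \<in> borel_measurable (lebesgue_on {0..L})"
    by (rule measurable_restrict_space1, rule measurable_completion) simp
  have int: "integrable (lebesgue_on {0..L}) (\<lambda>y. u0 y * \<phi> y)"
  proof (rule Bochner_Integration.integrable_bound)
    show "integrable (lebesgue_on {0..L}) (\<lambda>y. sqrt (2 / L) * u0 y)" using ui by simp
    show "AE y in lebesgue_on {0..L}. norm (u0 y * \<phi> y) \<le> norm (sqrt (2 / L) * u0 y)"
      using mult_right_mono[OF dir_eigenfun_bound[OF L] abs_ge_zero] L
      by (intro AE_I2) (simp add: abs_mult mult.commute)
  qed (intro borel_measurable_times u0(1) ph)
  have nn: "AE y in lebesgue_on {0..L}. 0 \<le> u0 y * \<phi> y"
    using u0(2) dir_eigenfun_1_nonneg by (intro AE_I2) (auto simp: space_restrict_space)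
  have "(\<integral>y. u0 y * \<phi> y \<partial>lebesgue_on {0..L}) \<noteq> 0"
  proof
    assume "(\<integral>y. u0 y * \<phi> y \<partial>lebesgue_on {0..L}) = 0"
    then have "AE y in lebesgue_on {0..L}. u0 y * \<phi> y = 0"
      using integral_nonneg_eq_0_iff_AE[OF int nn] by simp
    then have "AE y in lebesgue. y \<in> {0..L} \<longrightarrow> u0 y * \<phi> y = 0"
      by (subst (asm) AE_restrict_space_iff) auto
    \<comment> \<open>Inside [0,L] the eigenfunction \<phi> vanishes only at the endpoints, a null
      set, so a zero integral would force u0 = 0 almost everywhere.\<close>
    moreover have "AE y in lebesgue. y \<noteq> 0 \<and> y \<noteq> L"
      using AE_completion[OF AE_lborel_singleton[of 0]] AE_completion[OF AE_lborel_singleton[of L]] by auto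
    ultimately have "AE y in lebesgue. y \<notin> {x \<in> {0..L}. 0 < u0 x}"
    proof eventually_elim
      case (elim y)
      then show ?case using dir_eigenfun_1_pos[of y L] by (auto simp: less_le)
    qed
    moreover have "{x \<in> {0..L}. 0 < u0 x} \<in> sets lebesgue"
    proof -
      have "{x \<in> space (lebesgue_on {0..L}). 0 < u0 x} \<in> sets (lebesgue_on {0..L})"
        by (intro borel_measurable_less borel_measurable_const u0(1))
      moreover have "{x \<in> space (lebesgue_on {0..L}). 0 < u0 x} = {x \<in> {0..L}. 0 < u0 x}"
        unfolding space_restrict_space by simp
      moreover have S: "{0..L} \<inter> space lebesgue \<in> sets lebesgue" by simp
      ultimately show ?thesis using sets_restrict_space_iff[OF S] by metis
    qed
    moreover have "{y \<in> space lebesgue. \<not> y \<notin> N} = N" for N :: "real set" by auto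
    ultimately have "emeasure lebesgue {x \<in> {0..L}. 0 < u0 x} = 0"
      using AE_iff_measurable[where M=lebesgue and P="\<lambda>y. y \<notin> {x \<in> {0..L}. 0 < u0 x}"] by blast
    with u0(4) show False by (simp only: less_irrefl)
  qed
  moreover have "(\<integral>y. u0 y * \<phi> y \<partial>lebesgue_on {0..L}) \<ge> 0" by (rule integral_nonneg_AE[OF nn])
  ultimately show "(\<integral>y. u0 y * \<phi> y \<partial>lebesgue_on {0..L}) > 0" by linarith
qed

end

section \<open>The renewal inequality\<close>

text \<open>The growth bound is propagated in time steps of length 1, using only the part \<open>1 \<le> t - s \<le> T\<close> of the
  renewal kernel, whose lower bound \<open>c / (t - s)\<close> integrates to \<open>2 / B\<close>.\<close>

lemma renewal_exponential_growth:
  fixes m :: "real \<Rightarrow> ennreal" and e :: "real \<Rightarrow> real"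
  assumes pos: "A > 0" "B > 0" "c > 0"
    and epos: "\<And>t. t > 0 \<Longrightarrow> e t > 0"
    and anti: "\<And>s t. 0 < s \<Longrightarrow> s \<le> t \<Longrightarrow> e t \<le> e s"
    and decay: "\<And>r. r \<ge> 1 \<Longrightarrow> c / r \<le> (e r)\<^sup>2"
    and init: "\<And>t. t > 0 \<Longrightarrow> ennreal (A * (e t)\<^sup>2) \<le> m t"
    and renewal: "\<And>t. t > 0 \<Longrightarrow>
      (\<integral>\<^sup>+s. ennreal (B * (e (t - s))\<^sup>2) * m s * indicator {0<..<t} s \<partial>lborel) \<le> m t"
  shows "\<exists>c \<gamma> T :: real. c > 0 \<and> \<gamma> > 0 \<and> T > 0 \<and> (\<forall>t\<ge>T. ennreal (c * exp (\<gamma> * t)) \<le> m t)"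
proof -
  define T where "T = exp (2 / (B * c))"
  \<comment> \<open>exp (\<gamma> * T) = 2: over the window exp (\<gamma> * s) falls below exp
    (\<gamma> * t) by a factor of at most 2, for which the kernel mass on the window, at least 2,
    makes up.\<close>
  define \<gamma> where "\<gamma> = ln 2 / T"
  \<comment> \<open>Normalised so that at t = T the bound equals A e(T)^2, the least value of the
    initial term on (0,T]; this gives the base case.\<close>
  define c1 where "c1 = A * (e T)\<^sup>2 * exp (- \<gamma> * T)"
  have T: "T > 1" "ln T = 2 / (B * c)" using pos by (auto simp: T_def)
  have g: "\<gamma> > 0" "\<gamma> * T = ln 2" using T by (auto simp: \<gamma>_def)
  have c1: "c1 > 0" using pos epos[of T] T by (auto simp: c1_def)
  have main: "\<forall>t. 0 < t \<and> t \<le> T + real n \<longrightarrow> ennreal (c1 * exp (\<gamma> * t)) \<le> m t" for n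
  proof (induction n)
    case 0
    show ?case
    proof (intro allI impI)
      fix t assume t: "0 < t \<and> t \<le> T + real 0"
      have "c1 * exp (\<gamma> * t) = A * (e T)\<^sup>2 * exp (\<gamma> * t - \<gamma> * T)"
        by (simp add: c1_def exp_diff exp_minus divide_inverse)
      also have "\<dots> \<le> A * (e T)\<^sup>2 * 1"
        using mult_left_mono[of t T \<gamma>] t g pos by (intro mult_left_mono) auto
      also have "\<dots> \<le> A * (e t)\<^sup>2"
        using t pos anti[of t T] epos[of T] T by (simp add: power_mono)
      finally show "ennreal (c1 * exp (\<gamma> * t)) \<le> m t"
        using init[of t] t by (meson ennreal_leI order_trans)
    qed
  next
    case (Suc n)
    show ?case
    proof (intro allI impI)
      fix t assume t: "0 < t \<and> t \<le> T + real (Suc n)"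
      show "ennreal (c1 * exp (\<gamma> * t)) \<le> m t"
      proof (cases "t \<le> T + real n")
        case True then show ?thesis using Suc.IH t by blast
      next
        case False
        \<comment> \<open>As T + n < t <= T + n + 1, the window [t - T, t - 1] lies in (0, T + n],
          where the induction hypothesis applies. In \<open>?k\<close> the factor exp (\<gamma> * s)
          is replaced by its least value on the window.\<close>
        let ?k = "B * c * c1 * exp (\<gamma> * (t - T))"
        have k0: "?k \<ge> 0" using pos c1 by simp
        have "(\<integral>\<^sup>+s. ennreal (1 / (t - s)) * indicator {t - T..t - 1} s \<partial>lborel) = - ln (t - (t - 1)) - - ln (t - (t - T))"
          using T by (intro nn_integral_FTC_Icc) (auto intro!: derivative_eq_intros simp: divide_simps)
        then have int: "(\<integral>\<^sup>+s. ennreal (1 / (t - s)) * indicator {t - T..t - 1} s \<partial>lborel) = ennreal (2 / (B * c))"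
          using T by simp
        have "exp (\<gamma> * (t - T)) = exp (\<gamma> * t) / 2"
          using g by (simp add: right_diff_distrib exp_diff)
        then have eq: "c1 * exp (\<gamma> * t) = ?k * (2 / (B * c))" using pos by simp
        have "ennreal (c1 * exp (\<gamma> * t)) = ennreal ?k * ennreal (2 / (B * c))"
          unfolding eq using k0 pos by (intro ennreal_mult) auto
        also have "\<dots> = (\<integral>\<^sup>+s. ennreal ?k * (ennreal (1 / (t - s)) * indicator {t - T..t - 1} s) \<partial>lborel)"
          unfolding int[symmetric] by (intro nn_integral_cmult[symmetric]) measurable
        also have "\<dots> \<le> (\<integral>\<^sup>+s. ennreal (B * (e (t - s))\<^sup>2) * m s * indicator {0<..<t} s \<partial>lborel)"
        proof (intro nn_integral_mono)
          fix s
          show "ennreal ?k * (ennreal (1 / (t - s)) * indicator {t - T..t - 1} s)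
            \<le> ennreal (B * (e (t - s))\<^sup>2) * m s * indicator {0<..<t} s"
          proof (cases "s \<in> {t - T..t - 1}")
            case s: True
            then have sp: "0 < s" "s < t" "s \<le> T + real n" using False t T by auto
            have "ennreal ?k * (ennreal (1 / (t - s)) * indicator {t - T..t - 1} s)
              = ennreal (B * (c / (t - s))) * ennreal (c1 * exp (\<gamma> * (t - T)))"
              using s sp k0 pos c1 by (simp add: ennreal_mult[symmetric] mult_ac)
            also have "\<dots> \<le> ennreal (B * (e (t - s))\<^sup>2) * ennreal (c1 * exp (\<gamma> * s))"
              using s sp pos c1 g decay[of "t - s"] by (intro mult_mono ennreal_leI mult_left_mono) auto
            also have "\<dots> \<le> ennreal (B * (e (t - s))\<^sup>2) * m s"
              using Suc.IH sp by (intro mult_left_mono) auto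
            finally show ?thesis using sp by simp
          qed simp
        qed
        also have "\<dots> \<le> m t" using renewal t by blast
        finally show ?thesis .
      qed
    qed
  qed
  have "ennreal (c1 * exp (\<gamma> * t)) \<le> m t" if "t \<ge> 1" for t
  proof -
    obtain n :: nat where "t \<le> real n" using real_arch_simple by blast
    then show ?thesis using main[of n] that T by auto
  qed
  then show ?thesis using c1 g(1) by (intro exI[of _ c1] exI[of _ \<gamma>] exI[of _ 1]) auto
qed

text \<open>The power 2 is crude but uniform: for t >= 1 the lower bound t^(-2\<beta>) is at least
  t^(-2) for every \<beta> < 1.\<close>

lemma exponential_decay_contradiction:
  fixes A C \<gamma> T :: real
  assumes "A > 0" "\<gamma> > 0" and le: "\<And>t. t \<ge> T \<Longrightarrow> A / t\<^sup>2 \<le> C * exp (- \<gamma> * t)"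
  shows False
proof -
  have "((\<lambda>t. C * exp (- \<gamma> * t) * t\<^sup>2) \<longlongrightarrow> 0) at_top"
    using assms by real_asymp
  then have "eventually (\<lambda>t. C * exp (- \<gamma> * t) * t\<^sup>2 < A) at_top"
    using assms by (intro order_tendstoD)
  moreover have "eventually (\<lambda>t::real. t \<ge> max T 1) at_top" by (rule eventually_ge_at_top)
  ultimately have "eventually (\<lambda>t::real. False) at_top"
  proof eventually_elim
    case (elim t)
    then have "A \<le> C * exp (- \<gamma> * t) * t\<^sup>2" using le[of t] by (simp add: field_simps)
    then show False using elim by simp
  qed
  then show False by simp
qed

section \<open>The Walsh isometry\<close>

lemma integrable_mult_of_power2:
  fixes f g :: "'a \<Rightarrow> real"
  assumes [measurable]: "f \<in> borel_measurable M" "g \<in> borel_measurable M"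
    and "integrable M (\<lambda>x. (f x)\<^sup>2)" "integrable M (\<lambda>x. (g x)\<^sup>2)"
  shows "integrable M (\<lambda>x. f x * g x)"
proof (rule Bochner_Integration.integrable_bound)
  show "integrable M (\<lambda>x. (f x)\<^sup>2 + (g x)\<^sup>2)" using assms by simp
  show "AE x in M. norm (f x * g x) \<le> norm ((f x)\<^sup>2 + (g x)\<^sup>2)"
  proof (rule AE_I2)
    fix x
    have "2 * \<bar>f x\<bar> * \<bar>g x\<bar> \<le> \<bar>f x\<bar>\<^sup>2 + \<bar>g x\<bar>\<^sup>2" by (rule sum_squares_bound)
    moreover have "0 \<le> \<bar>f x\<bar> * \<bar>g x\<bar>" by simp
    ultimately have "\<bar>f x\<bar> * \<bar>g x\<bar> \<le> \<bar>f x\<bar>\<^sup>2 + \<bar>g x\<bar>\<^sup>2" by linarith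
    then show "norm (f x * g x) \<le> norm ((f x)\<^sup>2 + (g x)\<^sup>2)" by (simp add: abs_mult)
  qed
qed measurable

lemma (in pair_sigma_finite) has_bochner_integral_product:
  fixes f :: "'a \<Rightarrow> real" and g :: "'b \<Rightarrow> real"
  assumes f: "has_bochner_integral M1 f a" and g: "has_bochner_integral M2 g b"
  shows "has_bochner_integral (M1 \<Otimes>\<^sub>M M2) (\<lambda>(x, y). f x * g y) (a * b)"
proof -
  have fi: "integrable M1 f" and gi: "integrable M2 g" using f g by (auto simp: has_bochner_integral_iff)
  have [measurable]: "f \<in> borel_measurable M1" "g \<in> borel_measurable M2" using fi gi by auto
  have int: "integrable (M1 \<Otimes>\<^sub>M M2) (\<lambda>(x, y). f x * g y)"
    by (rule Fubini_integrable) (use fi gi in \<open>auto simp: abs_mult\<close>)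
  from integral_fst'[OF this] show ?thesis
    using f g int by (simp add: has_bochner_integral_iff mult.commute)
qed

section \<open>Covariance of the noise and independence of past and future\<close>

lemma noise_sets_borel:
  assumes "A \<in> noise_sets L"
  shows "A \<in> sets borel"
  using assms by (simp add: noise_sets_def)

lemma noise_sets_Int: "A \<in> noise_sets L \<Longrightarrow> B \<in> sets borel \<Longrightarrow> A \<inter> B \<in> noise_sets L"
  unfolding noise_sets_def
  by (auto intro: le_less_trans[OF emeasure_mono])

lemma noise_sets_Diff: "A \<in> noise_sets L \<Longrightarrow> B \<in> sets borel \<Longrightarrow> A - B \<in> noise_sets L"
  using noise_sets_Int[of A L "- B"] by (simp add: Diff_eq)

lemma
  assumes "0 \<le> a" "a \<le> b" "A \<in> sets borel" "A \<subseteq> {0..L}"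
  shows box_in_noise_sets: "{a<..b} \<times> A \<in> noise_sets L"
    and measure_box: "measure lborel ({a<..b} \<times> A) = (b - a) * measure lborel A"
proof -
  have em: "emeasure lborel ({a<..b} \<times> A) = emeasure lborel {a<..b} * emeasure lborel A"
    using assms by (subst lborel_prod[symmetric], subst lborel.emeasure_pair_measure_Times) auto
  have "emeasure lborel A \<le> emeasure lborel {0..L}" using assms by (intro emeasure_mono) auto
  also have "\<dots> < \<infinity>" by (simp add: emeasure_lborel_Icc_eq)
  finally have fin: "emeasure lborel A < \<infinity>" .
  show "{a<..b} \<times> A \<in> noise_sets L"
    using assms fin unfolding noise_sets_def
    by (auto simp: em ennreal_mult_less_top intro!: borel_Times)
  show "measure lborel ({a<..b} \<times> A) = (b - a) * measure lborel A"
    unfolding measure_def em using assms by (simp add: enn2real_mult)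
qed

context white_noise
begin

lemma W_meas [measurable]: "A \<in> noise_sets L \<Longrightarrow> W A \<in> borel_measurable M"
  by (rule measurable_W)

lemma W_moments:
  assumes A: "A \<in> noise_sets L"
  shows "integrable M (W A)" "expectation (W A) = 0"
    "integrable M (\<lambda>\<omega>. (W A \<omega>)\<^sup>2)" "expectation (\<lambda>\<omega>. (W A \<omega>)\<^sup>2) = measure lborel A"
proof -
  note [measurable] = W_meas[OF A]
  have "integrable M (W A) \<and> expectation (W A) = 0 \<and> integrable M (\<lambda>\<omega>. (W A \<omega>)\<^sup>2)
    \<and> expectation (\<lambda>\<omega>. (W A \<omega>)\<^sup>2) = measure lborel A"
  proof (cases "measure lborel A > 0")
    case True
    let ?s = "sqrt (measure lborel A)"
    have s: "?s > 0" using True by simp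
    note D = normal_W[OF A True]
    have "integrable M (\<lambda>\<omega>. W A \<omega> ^ k)" for k
      using distributed_integrable[OF D, of "\<lambda>x. x ^ k"] integrable_normal_moment[OF s, of 0 k] by simp
    from this[of 1] this[of 2] show ?thesis
      using normal_distributed_expectation[OF s D] normal_distributed_variance[OF s D] True by simp
  next
    case False
    then have "measure lborel A = 0" using zero_less_measure_iff by blast
    then have "AE \<omega> in M. W A \<omega> = 0" by (rule null_W[OF A])
    then have ae: "AE \<omega> in M. W A \<omega> = (\<lambda>_. 0) \<omega>" "AE \<omega> in M. (W A \<omega>)\<^sup>2 = (\<lambda>_. 0) \<omega>" by auto
    show ?thesis
      using integrable_cong_AE[OF _ _ ae(1)] integral_cong_AE[OF _ _ ae(1)]
        integrable_cong_AE[OF _ _ ae(2)] integral_cong_AE[OF _ _ ae(2)] \<open>measure lborel A = 0\<close> by simp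
  qed
  then show "integrable M (W A)" "expectation (W A) = 0"
    "integrable M (\<lambda>\<omega>. (W A \<omega>)\<^sup>2)" "expectation (\<lambda>\<omega>. (W A \<omega>)\<^sup>2) = measure lborel A" by auto
qed

lemma has_bochner_integral_W:
  "A \<in> noise_sets L \<Longrightarrow> has_bochner_integral M (W A) 0"
  using W_moments by (simp add: has_bochner_integral_iff)

lemma integrable_W_mult:
  assumes "A \<in> noise_sets L" "B \<in> noise_sets L"
  shows "integrable M (\<lambda>\<omega>. W A \<omega> * W B \<omega>)"
  using assms by (intro integrable_mult_of_power2 W_moments W_meas)

lemma W_cov_disjoint:
  assumes A: "A \<in> noise_sets L" and B: "B \<in> noise_sets L" and disj: "A \<inter> B = {}"
  shows "expectation (\<lambda>\<omega>. W A \<omega> * W B \<omega>) = 0"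
\<comment> \<open>Disjoint sets coincide when both are empty; \<open>{A, B}\<close> then has one
  element and independence says nothing about the product.\<close>
proof (cases "A = B")
  case True
  then have "A = {}" using disj by auto
  then show ?thesis using W_moments(4)[OF A] True by (simp add: power2_eq_square)
next
  case False
  have "indep_vars (\<lambda>_. borel) W {A, B}"
    using A B disj by (intro indep_W) (auto simp: pairwise_def disjnt_def)
  then have "(\<integral>\<omega>. (\<Prod>i\<in>{A, B}. W i \<omega>) \<partial>M) = (\<Prod>i\<in>{A, B}. \<integral>\<omega>. W i \<omega> \<partial>M)"
    using A B by (intro indep_vars_lebesgue_integral) (auto intro: W_moments)
  then show ?thesis using False W_moments(2)[OF A] by simp
qed

lemma W_split:
  assumes A: "A \<in> noise_sets L" and B: "B \<in> sets borel"
  shows "AE \<omega> in M. W A \<omega> = W (A \<inter> B) \<omega> + W (A - B) \<omega>"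
proof -
  have "(A \<inter> B) \<union> (A - B) = A" by auto
  then show ?thesis
    using additive_W[OF noise_sets_Int[OF A B] noise_sets_Diff[OF A B]] by auto
qed

text \<open>Both sets are split along C = A \<inter> B. Of the four products only W C * W C does not
  come from disjoint sets, and it contributes the variance.\<close>

lemma W_cov:
  assumes A: "A \<in> noise_sets L" and B: "B \<in> noise_sets L"
  shows "has_bochner_integral M (\<lambda>\<omega>. W A \<omega> * W B \<omega>) (measure lborel (A \<inter> B))"
proof -
  note Ab = noise_sets_borel[OF A] and Bb = noise_sets_borel[OF B]
  define C where "C = A \<inter> B"
  have N: "C \<in> noise_sets L" "A - B \<in> noise_sets L" "B - A \<in> noise_sets L"
    unfolding C_def by (intro noise_sets_Int noise_sets_Diff A B Ab Bb)+
  note [measurable] = W_meas[OF A] W_meas[OF B] W_meas[OF N(1)] W_meas[OF N(2)] W_meas[OF N(3)]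
  let ?S = "\<lambda>\<omega>. W C \<omega> * W C \<omega> + W C \<omega> * W (B - A) \<omega> + (W (A - B) \<omega> * W C \<omega> + W (A - B) \<omega> * W (B - A) \<omega>)"
  have CC: "has_bochner_integral M (\<lambda>\<omega>. W C \<omega> * W C \<omega>) (measure lborel C)"
    using W_moments(3,4)[OF N(1)] by (simp add: has_bochner_integral_iff power2_eq_square)
  have D: "has_bochner_integral M (\<lambda>\<omega>. W P \<omega> * W Q \<omega>) 0"
    if "P \<in> noise_sets L" "Q \<in> noise_sets L" "P \<inter> Q = {}" for P Q
    using W_cov_disjoint[OF that] integrable_W_mult[OF that(1,2)] by (simp add: has_bochner_integral_iff)
  have "has_bochner_integral M ?S (measure lborel C + 0 + (0 + 0))"
    by (intro has_bochner_integral_add CC D N) (auto simp: C_def)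
  then have S: "has_bochner_integral M ?S (measure lborel C)" by simp
  have "has_bochner_integral M (\<lambda>\<omega>. W A \<omega> * W B \<omega>) (measure lborel C)"
  proof (rule has_bochner_integralI_AE[OF S])
    show "AE \<omega> in M. ?S \<omega> = W A \<omega> * W B \<omega>"
      using W_split[OF A Bb] W_split[OF B Ab]
      by eventually_elim (simp add: C_def algebra_simps Int_commute)
  qed measurable
  then show ?thesis by (simp add: C_def)
qed

text \<open>Together with \<open>indep_future_W\<close>: increments after time \<open>t\<close> are independent of \<open>F t\<close>.\<close>

definition future :: "real \<Rightarrow> 'a measure" where
  "future t = sigma (space M) {W A -` B \<inter> space M | A B.
     A \<in> noise_sets L \<and> A \<subseteq> {t<..} \<times> {0..L} \<and> B \<in> sets borel}"

lemma space_future [simp]: "space (future t) = space M"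
  unfolding future_def by (rule space_measure_of) auto

lemma sets_future: "sets (future t) = sigma_sets (space M) {W A -` B \<inter> space M | A B.
     A \<in> noise_sets L \<and> A \<subseteq> {t<..} \<times> {0..L} \<and> B \<in> sets borel}"
  unfolding future_def by (rule sets_measure_of) auto

lemma W_future:
  assumes "A \<in> noise_sets L" "A \<subseteq> {t<..} \<times> {0..L}"
  shows "W A \<in> borel_measurable (future t)"
proof (rule measurableI)
  fix B :: "real set" assume "B \<in> sets borel"
  then show "W A -` B \<inter> space (future t) \<in> sets (future t)"
    unfolding space_future sets_future using assms by (intro sigma_sets.Basic) auto
qed auto

lemma measurable_F_mono:
  assumes "s \<le> t" "f \<in> measurable (F s) N"
  shows "f \<in> measurable (F t) N"
  using assms sets_F_mono[OF assms(1)] by (auto simp: measurable_def space_F)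

lemma measurable_F_M: "f \<in> measurable (F s) N \<Longrightarrow> f \<in> measurable M N"
  using F_subset[of s] by (auto simp: measurable_def space_F)

lemma expectation_past_future:
  fixes Z Y :: "'a \<Rightarrow> real"
  assumes "0 \<le> t" and Z: "Z \<in> borel_measurable (F t)" and Y: "Y \<in> borel_measurable (future t)"
    and Zi: "integrable M Z" and Yi: "has_bochner_integral M Y y"
  shows "has_bochner_integral M (\<lambda>\<omega>. Z \<omega> * Y \<omega>) (expectation Z * y)"
proof -
  have Ym: "Y \<in> borel_measurable M" and Zm: "Z \<in> borel_measurable M" using Yi Zi by auto
  have "indep_set (sigma_sets (space M) {Z -` A \<inter> space M |A. A \<in> sets borel})
      (sigma_sets (space M) {Y -` A \<inter> space M |A. A \<in> sets borel})"
    unfolding indep_set_def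
  proof (rule indep_sets_mono_sets[OF indep_future_W[OF assms(1), unfolded indep_set_def]])
    fix i
    have "sigma_sets (space M) {Z -` A \<inter> space M |A. A \<in> sets borel} \<subseteq> sets (F t)"
    proof -
      have "{Z -` A \<inter> space M |A. A \<in> sets borel} \<subseteq> sets (F t)"
        using measurable_sets[OF Z] by (auto simp: space_F)
      from sets.sigma_sets_subset[OF this] show ?thesis by (simp add: space_F)
    qed
    moreover have "sigma_sets (space M) {Y -` A \<inter> space M |A. A \<in> sets borel} \<subseteq> sets (future t)"
    proof -
      have "{Y -` A \<inter> space M |A. A \<in> sets borel} \<subseteq> sets (future t)"
        using measurable_sets[OF Y] by auto
      from sets.sigma_sets_subset[OF this] show ?thesis by simp
    qed
    ultimately show "(case i of True \<Rightarrow> sigma_sets (space M) {Z -` A \<inter> space M |A. A \<in> sets borel}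
       | False \<Rightarrow> sigma_sets (space M) {Y -` A \<inter> space M |A. A \<in> sets borel})
      \<subseteq> (case i of True \<Rightarrow> sets (F t) | False \<Rightarrow>
          (sigma_sets (space M)
            {W A -` B \<inter> space M | A B.
               A \<in> noise_sets L \<and> A \<subseteq> {t<..} \<times> {0..L} \<and> B \<in> sets borel}))"
      unfolding sets_future by (cases i) simp_all
  qed
  then have "indep_var borel Z borel Y" unfolding indep_var_eq using Ym Zm by blast
  then show ?thesis
    using indep_var_lebesgue_integral[of Z Y] indep_var_integrable[of Z Y] Zi Yi
    by (simp add: has_bochner_integral_iff)
qed

lemma integrable_bounded_mult:
  fixes X Y :: "'a \<Rightarrow> real"
  assumes "X \<in> borel_measurable M" "bounded (X ` space M)" "integrable M Y"
  shows "integrable M (\<lambda>\<omega>. X \<omega> * Y \<omega>)"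
proof -
  obtain K where K: "\<And>\<omega>. \<omega> \<in> space M \<Longrightarrow> norm (X \<omega>) \<le> K" using assms(2) by (auto simp: bounded_iff)
  have [measurable]: "X \<in> borel_measurable M" "Y \<in> borel_measurable M" using assms by auto
  have "integrable M (\<lambda>\<omega>. K * Y \<omega>)" using assms by simp
  then show ?thesis
  proof (rule Bochner_Integration.integrable_bound)
    show "AE \<omega> in M. norm (X \<omega> * Y \<omega>) \<le> norm (K * Y \<omega>)"
    proof (rule AE_I2)
      fix \<omega> assume "\<omega> \<in> space M"
      then have "\<bar>X \<omega>\<bar> \<le> \<bar>K\<bar>" using K[of \<omega>] by simp
      then show "norm (X \<omega> * Y \<omega>) \<le> norm (K * Y \<omega>)" by (simp add: abs_mult mult_right_mono)
    qed
  qed measurable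
qed

section \<open>The isometry for simple fields\<close>

definition walsh_term :: "('a \<Rightarrow> real) \<times> real \<times> real \<times> real set \<Rightarrow> 'a \<Rightarrow> real" where
  "walsh_term = (\<lambda>(X, a, b, A) \<omega>. X \<omega> * W ({a<..b} \<times> A) \<omega>)"

definition field_term :: "('a \<Rightarrow> real) \<times> real \<times> real \<times> real set \<Rightarrow> real \<times> real \<times> 'a \<Rightarrow> real" where
  "field_term = (\<lambda>(X, a, b, A) (s, y, \<omega>). X \<omega> * indicator {a<..b} s * indicator A y)"

text \<open>The first box is split at time \<open>a2\<close>: the earlier part is \<open>F a2\<close>-measurable together with both
  coefficients, the later part and the second box are independent of \<open>F a2\<close>.\<close>

lemma walsh_term_cov_ordered:
  assumes 1: "simple_field M F L [(X1, a1, b1, A1)]" and 2: "simple_field M F L [(X2, a2, b2, A2)]"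
    and le: "a1 \<le> a2"
  shows "has_bochner_integral M (\<lambda>\<omega>. walsh_term (X1, a1, b1, A1) \<omega> * walsh_term (X2, a2, b2, A2) \<omega>)
    (expectation (\<lambda>\<omega>. X1 \<omega> * X2 \<omega>) *
      (measure lborel ({a1<..b1} \<inter> {a2<..b2}) * measure lborel (A1 \<inter> A2)))"
proof -
  have e1: "0 \<le> a1" "a1 \<le> b1" "A1 \<in> sets borel" "A1 \<subseteq> {0..L}"
      "X1 \<in> borel_measurable (F a1)" "bounded (X1 ` space M)"
    and e2: "0 \<le> a2" "a2 \<le> b2" "A2 \<in> sets borel" "A2 \<subseteq> {0..L}"
      "X2 \<in> borel_measurable (F a2)" "bounded (X2 ` space M)"
    using 1 2 by (auto simp: simple_field_def)
  \<comment> \<open>\<open>min\<close> and \<open>max\<close> cover the case b1 <= a2 as well: then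
    P is the whole first box and Q is empty.\<close>
  define P where "P = {a1<..min a2 b1} \<times> A1"
  define Q where "Q = {a2<..max a2 b1} \<times> A1"
  define B where "B = {a2<..b2} \<times> A2"
  have N: "P \<in> noise_sets L" "Q \<in> noise_sets L" "B \<in> noise_sets L"
    unfolding P_def Q_def B_def using e1 e2 le by (auto intro!: box_in_noise_sets)
  have PQ: "P \<union> Q = {a1<..b1} \<times> A1" "P \<inter> Q = {}" unfolding P_def Q_def using e1 le by auto
  have X: "X1 \<in> borel_measurable (F a2)" "X2 \<in> borel_measurable (F a2)"
    using e1 e2 measurable_F_mono[OF le] by auto
  have PF: "W P \<in> borel_measurable (F a2)"
    by (rule adapted_W) (use e1 e2 N in \<open>auto simp: P_def\<close>)
  have XM: "X1 \<in> borel_measurable M" "X2 \<in> borel_measurable M" "W P \<in> borel_measurable M"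
    using X N by (auto intro: measurable_F_M W_meas)
  have BF: "B \<subseteq> {a2<..} \<times> {0..L}" "Q \<subseteq> {a2<..} \<times> {0..L}" using e1 e2 by (auto simp: B_def Q_def)
  have "has_bochner_integral M (\<lambda>\<omega>. (X1 \<omega> * (X2 \<omega> * W P \<omega>)) * W B \<omega>)
      (expectation (\<lambda>\<omega>. X1 \<omega> * (X2 \<omega> * W P \<omega>)) * 0)"
    using e1 e2 X PF XM N BF
    by (intro expectation_past_future[of a2] has_bochner_integral_W integrable_bounded_mult W_moments
      W_future borel_measurable_times) auto
  moreover have "has_bochner_integral M (\<lambda>\<omega>. (X1 \<omega> * X2 \<omega>) * (W Q \<omega> * W B \<omega>))
      (expectation (\<lambda>\<omega>. X1 \<omega> * X2 \<omega>) * measure lborel (Q \<inter> B))"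
  proof (intro expectation_past_future[of a2] W_cov integrable_bounded_mult W_future borel_measurable_times)
    have "integrable M (\<lambda>\<omega>. X2 \<omega> * 1)" using XM e2 by (intro integrable_bounded_mult) auto
    then show "integrable M X2" by simp
  qed (use e1 e2 X XM N BF in auto)
  ultimately have *: "has_bochner_integral M
     (\<lambda>\<omega>. (X1 \<omega> * (X2 \<omega> * W P \<omega>)) * W B \<omega> + (X1 \<omega> * X2 \<omega>) * (W Q \<omega> * W B \<omega>))
     (expectation (\<lambda>\<omega>. X1 \<omega> * (X2 \<omega> * W P \<omega>)) * 0 + expectation (\<lambda>\<omega>. X1 \<omega> * X2 \<omega>) * measure lborel (Q \<inter> B))"
    by (rule has_bochner_integral_add)
  have QB: "measure lborel (Q \<inter> B) = measure lborel ({a1<..b1} \<inter> {a2<..b2}) * measure lborel (A1 \<inter> A2)"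
  proof -
    \<comment> \<open>The outer \<open>max a2\<close> keeps the upper end at or above a2, so that
      the box formula returns 0 when the time intervals do not meet.\<close>
    have "Q \<inter> B = {a2<..max a2 (min b1 b2)} \<times> (A1 \<inter> A2)"
      unfolding Q_def B_def using e1 e2 by auto
    moreover have "{a1<..b1} \<inter> {a2<..b2} = {a2<..max a2 (min b1 b2)}" using le e1 e2 by auto
    moreover have "measure lborel ({a2<..max a2 (min b1 b2)} \<times> (A1 \<inter> A2))
      = (max a2 (min b1 b2) - a2) * measure lborel (A1 \<inter> A2)"
      using e1 e2 by (intro measure_box[where L=L]) auto
    ultimately show ?thesis by simp
  qed
  have "has_bochner_integral M (\<lambda>\<omega>. walsh_term (X1, a1, b1, A1) \<omega> * walsh_term (X2, a2, b2, A2) \<omega>)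
     (expectation (\<lambda>\<omega>. X1 \<omega> * (X2 \<omega> * W P \<omega>)) * 0 + expectation (\<lambda>\<omega>. X1 \<omega> * X2 \<omega>) * measure lborel (Q \<inter> B))"
  proof (rule has_bochner_integralI_AE[OF *])
    show "(\<lambda>\<omega>. walsh_term (X1, a1, b1, A1) \<omega> * walsh_term (X2, a2, b2, A2) \<omega>) \<in> borel_measurable M"
      unfolding walsh_term_def prod.case
      by (intro borel_measurable_times W_meas box_in_noise_sets XM e1 e2)
    show "AE \<omega> in M. (X1 \<omega> * (X2 \<omega> * W P \<omega>)) * W B \<omega> + (X1 \<omega> * X2 \<omega>) * (W Q \<omega> * W B \<omega>)
      = walsh_term (X1, a1, b1, A1) \<omega> * walsh_term (X2, a2, b2, A2) \<omega>"
      using additive_W[OF N(1,2) PQ(2)] unfolding PQ(1)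
      by eventually_elim (simp add: walsh_term_def B_def algebra_simps)
  qed
  then show ?thesis by (simp add: QB)
qed

lemma walsh_term_cov:
  assumes 1: "simple_field M F L [(X1, a1, b1, A1)]" and 2: "simple_field M F L [(X2, a2, b2, A2)]"
  shows "has_bochner_integral M (\<lambda>\<omega>. walsh_term (X1, a1, b1, A1) \<omega> * walsh_term (X2, a2, b2, A2) \<omega>)
    (expectation (\<lambda>\<omega>. X1 \<omega> * X2 \<omega>) *
      (measure lborel ({a1<..b1} \<inter> {a2<..b2}) * measure lborel (A1 \<inter> A2)))"
proof (cases "a1 \<le> a2")
  case True then show ?thesis by (rule walsh_term_cov_ordered[OF 1 2])
next
  case False
  then have "a2 \<le> a1" by simp
  from walsh_term_cov_ordered[OF 2 1 this] show ?thesis by (simp add: mult.commute Int_commute)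
qed

lemma walsh_term_mean:
  assumes 1: "simple_field M F L [(X, a, b, A)]"
  shows "has_bochner_integral M (walsh_term (X, a, b, A)) 0"
proof -
  have e: "0 \<le> a" "a \<le> b" "A \<in> sets borel" "A \<subseteq> {0..L}"
      "X \<in> borel_measurable (F a)" "bounded (X ` space M)"
    using 1 by (auto simp: simple_field_def)
  have XM: "X \<in> borel_measurable M" by (rule measurable_F_M) fact
  have "integrable M (\<lambda>\<omega>. X \<omega> * 1)" using XM e by (intro integrable_bounded_mult) auto
  moreover have N: "{a<..b} \<times> A \<in> noise_sets L" using e by (intro box_in_noise_sets)
  ultimately have "has_bochner_integral M (\<lambda>\<omega>. X \<omega> * W ({a<..b} \<times> A) \<omega>) (expectation X * 0)"
    using e by (intro expectation_past_future[of a] W_future has_bochner_integral_W) auto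
  then show ?thesis by (simp add: walsh_term_def)
qed

text \<open>The value is literally that of \<open>walsh_term_cov\<close>: together they are the
  isometry in polarised form for single boxes. Independence of increments there corresponds here to
  Fubini over time, space and \<omega>.\<close>

lemma field_term_cov:
  assumes 1: "simple_field M F L [(X1, a1, b1, A1)]" and 2: "simple_field M F L [(X2, a2, b2, A2)]"
  shows "has_bochner_integral (field_measure M L)
    (\<lambda>p. field_term (X1, a1, b1, A1) p * field_term (X2, a2, b2, A2) p)
    (expectation (\<lambda>\<omega>. X1 \<omega> * X2 \<omega>) *
      (measure lborel ({a1<..b1} \<inter> {a2<..b2}) * measure lborel (A1 \<inter> A2)))"
proof -
  let ?T = "restrict_space lborel {0::real<..}" and ?Y = "restrict_space lborel {0..L}"
  have e1: "0 \<le> a1" "a1 \<le> b1" "A1 \<in> sets borel" "A1 \<subseteq> {0..L}"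
      "X1 \<in> borel_measurable (F a1)" "bounded (X1 ` space M)"
    and e2: "0 \<le> a2" "a2 \<le> b2" "A2 \<in> sets borel" "A2 \<subseteq> {0..L}"
      "X2 \<in> borel_measurable (F a2)" "bounded (X2 ` space M)"
    using 1 2 by (auto simp: simple_field_def)
  have sf: "sigma_finite_measure ?T" "sigma_finite_measure ?Y"
    by (auto intro!: sigma_finite_measure_restrict_space sigma_finite_lborel)
  interpret T: sigma_finite_measure ?T by fact
  interpret Y: sigma_finite_measure ?Y by fact
  interpret YM: pair_sigma_finite ?Y M ..
  interpret TYM: pair_sigma_finite ?T "?Y \<Otimes>\<^sub>M M" ..
  have ind: "has_bochner_integral (restrict_space lborel S) (indicator D) (measure lborel D)"
    if "D \<subseteq> S" "D \<in> sets borel" "S \<in> sets borel" "emeasure lborel D < \<infinity>" for D S :: "real set"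
  proof -
    have "emeasure (restrict_space lborel S) D = emeasure lborel D"
      using that by (intro emeasure_restrict_space) auto
    moreover have "D \<in> sets (restrict_space lborel S)" using that by (auto simp: sets_restrict_space)
    ultimately show ?thesis
      using has_bochner_integral_real_indicator[of D "restrict_space lborel S"] that by (simp add: measure_def)
  qed
  have XM: "X1 \<in> borel_measurable M" "X2 \<in> borel_measurable M"
    using e1 e2 by (auto intro: measurable_F_M)
  have "integrable M (\<lambda>\<omega>. X2 \<omega> * 1)" using XM e2 by (intro integrable_bounded_mult) auto
  then have XX: "has_bochner_integral M (\<lambda>\<omega>. X1 \<omega> * X2 \<omega>) (expectation (\<lambda>\<omega>. X1 \<omega> * X2 \<omega>))"
    using XM e1 by (intro has_bochner_integral_integrable integrable_bounded_mult) auto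
  have fA: "emeasure lborel (A1 \<inter> A2) < \<infinity>"
  proof -
    have "emeasure lborel (A1 \<inter> A2) \<le> emeasure lborel {0..L}" using e1 e2 by (intro emeasure_mono) auto
    also have "\<dots> < \<infinity>" by (simp add: emeasure_lborel_Icc_eq)
    finally show ?thesis .
  qed
  have fT: "emeasure lborel ({a1<..b1} \<inter> {a2<..b2}) < \<infinity>"
  proof -
    have "emeasure lborel ({a1<..b1} \<inter> {a2<..b2}) \<le> emeasure lborel {a1<..b1}" by (intro emeasure_mono) auto
    also have "\<dots> < \<infinity>" using e1 by simp
    finally show ?thesis .
  qed
  have "has_bochner_integral (?T \<Otimes>\<^sub>M (?Y \<Otimes>\<^sub>M M))
     (\<lambda>(s, q). indicator ({a1<..b1} \<inter> {a2<..b2}) s * (\<lambda>(y, \<omega>). indicator (A1 \<inter> A2) y * (X1 \<omega> * X2 \<omega>)) q)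
     (measure lborel ({a1<..b1} \<inter> {a2<..b2}) * (measure lborel (A1 \<inter> A2) * expectation (\<lambda>\<omega>. X1 \<omega> * X2 \<omega>)))"
    using e1 e2 fA fT
    by (intro TYM.has_bochner_integral_product YM.has_bochner_integral_product ind XX) auto
  then show ?thesis unfolding field_measure_def
    by (rule has_bochner_integral_cong[THEN iffD1, rotated 3])
      (auto simp: field_term_def indicator_def)
qed

lemma simple_field_nth:
  "simple_field M F L es \<Longrightarrow> i < length es \<Longrightarrow> simple_field M F L [es ! i]"
  by (auto simp: simple_field_def dest!: nth_mem)

lemma simple_walsh_integral_conv_sum:
  "simple_walsh_integral W es \<omega> = (\<Sum>i<length es. walsh_term (es ! i) \<omega>)"
  unfolding simple_walsh_integral_def walsh_term_def sum_list_sum_nth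
  by (simp add: lessThan_atLeast0 case_prod_unfold)

lemma simple_field_fun_conv_sum:
  "simple_field_fun es p = (\<Sum>i<length es. field_term (es ! i) p)"
  unfolding simple_field_fun_def field_term_def sum_list_sum_nth
  by (cases p) (simp add: lessThan_atLeast0 case_prod_unfold)

text \<open>The squares are expanded into all pairs; since the covariance is known for arbitrary
  pairs, overlapping boxes stay as they are. Stating a common Bochner value v brings integrability
  of both squares along.\<close>

lemma simple_walsh_isometry:
  assumes es: "simple_field M F L es"
  shows "\<exists>v. has_bochner_integral M (\<lambda>\<omega>. (simple_walsh_integral W es \<omega>)\<^sup>2) v \<and>
             has_bochner_integral (field_measure M L) (\<lambda>p. (simple_field_fun es p)\<^sup>2) v"
proof -
  have "\<exists>v. has_bochner_integral M (\<lambda>\<omega>. walsh_term (es ! i) \<omega> * walsh_term (es ! j) \<omega>) v \<and>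
     has_bochner_integral (field_measure M L) (\<lambda>p. field_term (es ! i) p * field_term (es ! j) p) v"
    if "i < length es" "j < length es" for i j
  proof -
    obtain X1 a1 b1 A1 X2 a2 b2 A2 where eq: "es ! i = (X1, a1, b1, A1)" "es ! j = (X2, a2, b2, A2)"
      by (metis prod.exhaust)
    show ?thesis
      using walsh_term_cov field_term_cov simple_field_nth[OF es that(1)] simple_field_nth[OF es that(2)]
      unfolding eq by blast
  qed
  note ex = this
  define v where "v i j = (SOME v. has_bochner_integral M (\<lambda>\<omega>. walsh_term (es ! i) \<omega> * walsh_term (es ! j) \<omega>) v \<and>
     has_bochner_integral (field_measure M L) (\<lambda>p. field_term (es ! i) p * field_term (es ! j) p) v)" for i j
  have v: "has_bochner_integral M (\<lambda>\<omega>. walsh_term (es ! i) \<omega> * walsh_term (es ! j) \<omega>) (v i j) \<and>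
     has_bochner_integral (field_measure M L) (\<lambda>p. field_term (es ! i) p * field_term (es ! j) p) (v i j)"
    if "i < length es" "j < length es" for i j
    unfolding v_def by (rule someI_ex[OF ex[OF that]])
  show ?thesis
    unfolding simple_walsh_integral_conv_sum simple_field_fun_conv_sum power2_eq_square sum_product
    using v by (intro exI[of _ "\<Sum>i<length es. \<Sum>j<length es. v i j"] conjI has_bochner_integral_sum) auto
qed

lemma simple_walsh_mean:
  assumes es: "simple_field M F L es"
  shows "has_bochner_integral M (simple_walsh_integral W es) 0"
proof -
  have "has_bochner_integral M (\<lambda>\<omega>. \<Sum>i<length es. walsh_term (es ! i) \<omega>) (\<Sum>i<length es. 0)"
  proof (intro has_bochner_integral_sum)
    fix i assume "i \<in> {..<length es}"
    then have "simple_field M F L [es ! i]" using simple_field_nth[OF es] by auto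
    then show "has_bochner_integral M (walsh_term (es ! i)) 0"
      by (cases "es ! i") (use walsh_term_mean in auto)
  qed
  then show ?thesis by (simp add: simple_walsh_integral_conv_sum[abs_def])
qed

text \<open>The simple integral has mean 0, so the cross term with g vanishes. The constant g stands
  for the deterministic part of the mild equation.\<close>

lemma second_moment_affine_simple_walsh:
  assumes es: "simple_field M F L es"
  shows "(\<integral>\<^sup>+\<omega>. ennreal ((g + c * simple_walsh_integral W es \<omega>)\<^sup>2) \<partial>M)
    = ennreal (g\<^sup>2) + ennreal (c\<^sup>2) * (\<integral>\<^sup>+p. ennreal ((simple_field_fun es p)\<^sup>2) \<partial>field_measure M L)"
proof -
  let ?S = "simple_walsh_integral W es"
  obtain v where v: "has_bochner_integral M (\<lambda>\<omega>. (?S \<omega>)\<^sup>2) v"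
    "has_bochner_integral (field_measure M L) (\<lambda>p. (simple_field_fun es p)\<^sup>2) v"
    using simple_walsh_isometry[OF es] by blast
  have v0: "v \<ge> 0" using v(1) integral_nonneg_AE[of "\<lambda>\<omega>. (?S \<omega>)\<^sup>2" M] by (auto simp: has_bochner_integral_iff)
  have "has_bochner_integral M (\<lambda>\<omega>. g\<^sup>2) (g\<^sup>2)"
    using prob_space by (simp add: has_bochner_integral_iff)
  then have "has_bochner_integral M (\<lambda>\<omega>. g\<^sup>2 + (2 * g * c) * ?S \<omega> + c\<^sup>2 * (?S \<omega>)\<^sup>2) (g\<^sup>2 + (2 * g * c) * 0 + c\<^sup>2 * v)"
    by (intro has_bochner_integral_add has_bochner_integral_mult_right v simple_walsh_mean es)
  also have "(\<lambda>\<omega>. g\<^sup>2 + (2 * g * c) * ?S \<omega> + c\<^sup>2 * (?S \<omega>)\<^sup>2) = (\<lambda>\<omega>. (g + c * ?S \<omega>)\<^sup>2)"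
    by (auto simp: power2_eq_square algebra_simps)
  finally have "(\<integral>\<^sup>+\<omega>. ennreal ((g + c * ?S \<omega>)\<^sup>2) \<partial>M) = ennreal (g\<^sup>2 + c\<^sup>2 * v)"
    by (subst nn_integral_eq_integral) (auto simp: has_bochner_integral_iff)
  moreover have "(\<integral>\<^sup>+p. ennreal ((simple_field_fun es p)\<^sup>2) \<partial>field_measure M L) = ennreal v"
    using v(2) by (subst nn_integral_eq_integral) (auto simp: has_bochner_integral_iff)
  ultimately show ?thesis using v0 by (simp add: ennreal_plus ennreal_mult)
qed

end

section \<open>Passage to the L^2 limit\<close>

text \<open>Young's inequality 2ab <= e a^2 + b^2 / e, integrated. It stands in for Minkowski's
  inequality and avoids square roots in \<open>ennreal\<close>.\<close>

lemma nn_integral_power2_add_le: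
  fixes f h :: "'a \<Rightarrow> real"
  assumes [measurable]: "f \<in> borel_measurable M" "h \<in> borel_measurable M" and e: "e > 0"
  shows "(\<integral>\<^sup>+x. ennreal ((f x + h x)\<^sup>2) \<partial>M)
    \<le> ennreal (1 + e) * (\<integral>\<^sup>+x. ennreal ((f x)\<^sup>2) \<partial>M) + ennreal (1 + 1 / e) * (\<integral>\<^sup>+x. ennreal ((h x)\<^sup>2) \<partial>M)"
proof -
  have ineq: "(a + b)\<^sup>2 \<le> (1 + e) * a\<^sup>2 + (1 + 1 / e) * b\<^sup>2" for a b :: real
  proof -
    have "0 \<le> (e * a - b)\<^sup>2 / e" using e by simp
    also have "(e * a - b)\<^sup>2 / e = e * a\<^sup>2 + b\<^sup>2 / e - 2 * a * b"
      using e by (simp add: power2_eq_square field_simps)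
    finally show ?thesis by (simp add: power2_sum algebra_simps)
  qed
  have "(\<integral>\<^sup>+x. ennreal ((f x + h x)\<^sup>2) \<partial>M)
    \<le> (\<integral>\<^sup>+x. ennreal (1 + e) * ennreal ((f x)\<^sup>2) + ennreal (1 + 1 / e) * ennreal ((h x)\<^sup>2) \<partial>M)"
  proof (intro nn_integral_mono)
    fix x
    have "ennreal ((f x + h x)\<^sup>2) \<le> ennreal ((1 + e) * (f x)\<^sup>2 + (1 + 1 / e) * (h x)\<^sup>2)"
      by (intro ennreal_leI ineq)
    also have "\<dots> = ennreal (1 + e) * ennreal ((f x)\<^sup>2) + ennreal (1 + 1 / e) * ennreal ((h x)\<^sup>2)"
      using e by (simp add: ennreal_mult ennreal_plus)
    finally show "ennreal ((f x + h x)\<^sup>2)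
      \<le> ennreal (1 + e) * ennreal ((f x)\<^sup>2) + ennreal (1 + 1 / e) * ennreal ((h x)\<^sup>2)" .
  qed
  also have "\<dots> = ennreal (1 + e) * (\<integral>\<^sup>+x. ennreal ((f x)\<^sup>2) \<partial>M) + ennreal (1 + 1 / e) * (\<integral>\<^sup>+x. ennreal ((h x)\<^sup>2) \<partial>M)"
    by (subst nn_integral_add) (auto simp: nn_integral_cmult)
  finally show ?thesis .
qed

lemma ennreal_le_of_le_one_plus:
  fixes x y :: ennreal
  assumes "\<And>e::real. e > 0 \<Longrightarrow> x \<le> ennreal ((1 + e)\<^sup>2) * y"
  shows "x \<le> y"
proof -
  have "(\<lambda>k. (1 + inverse (real (Suc k)))\<^sup>2) \<longlonglongrightarrow> (1 + 0)\<^sup>2"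
    by (intro tendsto_intros LIMSEQ_inverse_real_of_nat)
  then have "(\<lambda>k. ennreal ((1 + inverse (real (Suc k)))\<^sup>2) * y) \<longlonglongrightarrow> ennreal ((1 + 0)\<^sup>2) * y"
    by (intro tendsto_mult_ennreal tendsto_ennrealI tendsto_const) auto
  then show ?thesis
    by (intro LIMSEQ_le_const[where X="\<lambda>k. ennreal ((1 + inverse (real (Suc k)))\<^sup>2) * y"])
       (auto intro!: assms simp del: of_nat_Suc)
qed

lemma space_field_measure: "space (field_measure M L) = {0<..} \<times> {0..L} \<times> space M"
  by (simp add: field_measure_def space_pair_measure space_restrict_space)

context white_noise
begin

lemma field_box_sets:
  assumes "0 \<le> a" "A \<in> sets borel" "A \<subseteq> {0..L}" "H \<in> sets M"
  shows "{a<..b} \<times> A \<times> H \<in> sets (field_measure M L)"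
  unfolding field_measure_def
proof (intro pair_measureI)
  show "{a<..b} \<in> sets (restrict_space lborel {0::real<..})"
    using assms by (subst sets_restrict_space_iff) auto
  show "A \<in> sets (restrict_space lborel {0..L})"
    using assms by (subst sets_restrict_space_iff) auto
qed (rule assms)

text \<open>Each generating box is a measurable rectangle because F a consists of events of M. This
  opens predictable fields to Fubini.\<close>

lemma predictable_imp_field_measurable:
  assumes f: "f \<in> borel_measurable (predictable M F L)"
  shows "f \<in> borel_measurable (field_measure M L)"
proof -
  let ?G = "{{a<..b} \<times> A \<times> H | a b A H. 0 \<le> a \<and> A \<in> sets borel \<and> A \<subseteq> {0..L} \<and> H \<in> sets (F a)}"
  have Hs: "H \<subseteq> space M" if "H \<in> sets (F a)" for H a
    using sets.sets_into_space[OF that] by (simp add: space_F)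
  have sub: "?G \<subseteq> Pow ({0<..} \<times> {0..L} \<times> space M)"
  proof
    fix S assume "S \<in> ?G"
    then obtain a b A H where "S = {a<..b} \<times> A \<times> H" "0 \<le> a" "A \<subseteq> {0..L}" "H \<in> sets (F a)" by blast
    then show "S \<in> Pow ({0<..} \<times> {0..L} \<times> space M)" using Hs[of H a] by force
  qed
  have sp: "space (predictable M F L) = {0<..} \<times> {0..L} \<times> space M"
    unfolding predictable_def by (rule space_measure_of[OF sub])
  have "sets (predictable M F L) = sigma_sets ({0<..} \<times> {0..L} \<times> space M) ?G"
    unfolding predictable_def by (rule sets_measure_of[OF sub])
  also have "\<dots> \<subseteq> sets (field_measure M L)"
    unfolding space_field_measure[symmetric]
  proof (rule sets.sigma_sets_subset, rule subsetI)
    fix S assume "S \<in> ?G"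
    then obtain a b A H where "S = {a<..b} \<times> A \<times> H" "0 \<le> a" "A \<in> sets borel" "A \<subseteq> {0..L}" "H \<in> sets (F a)"
      by blast
    then show "S \<in> sets (field_measure M L)" using F_subset by (auto intro!: field_box_sets)
  qed
  finally have "sets (predictable M F L) \<subseteq> sets (field_measure M L)" .
  then show ?thesis using f sp space_field_measure[of M L] by (auto simp: measurable_def)
qed

lemma simple_field_fun_measurable:
  assumes es: "simple_field M F L es"
  shows "simple_field_fun es \<in> borel_measurable (field_measure M L)"
proof -
  have "field_term (es ! i) \<in> borel_measurable (field_measure M L)" if "i < length es" for i
  proof -
    obtain X a b A where eq: "es ! i = (X, a, b, A)" by (metis prod.exhaust)
    have e: "A \<in> sets borel" "X \<in> borel_measurable M"
      using simple_field_nth[OF es that] unfolding eq by (auto simp: simple_field_def intro: measurable_F_M)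
    have "(\<lambda>s. indicator {a<..b} s :: real) \<in> borel_measurable (restrict_space lborel {0<..})"
      "(\<lambda>y. indicator A y :: real) \<in> borel_measurable (restrict_space lborel {0..L})"
      by (rule measurable_restrict_space1, use e in simp)+
    note [measurable] = this e(2)
    have "(\<lambda>p. X (snd (snd p)) * indicator {a<..b} (fst p) * indicator A (fst (snd p)))
      \<in> borel_measurable (field_measure M L)"
      unfolding field_measure_def by measurable
    then show ?thesis by (simp add: eq field_term_def case_prod_beta')
  qed
  then show ?thesis
    unfolding simple_field_fun_conv_sum[abs_def] by (intro borel_measurable_sum) auto
qed

text \<open>Young's inequality is used twice, between f and the simple field and between its
  integral and I, with the isometry for simple fields in the middle; hence the factor (1 + e)^2. The
  errors carry 1 + 1/e, so e stays fixed while n tends to infinity and is removed only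
  afterwards.\<close>

lemma walsh_second_moment_ge:
  assumes I: "has_walsh_integral M F L W f I"
  shows "ennreal (g\<^sup>2) + ennreal (c\<^sup>2) * (\<integral>\<^sup>+p. ennreal ((f p)\<^sup>2) \<partial>field_measure M L)
    \<le> (\<integral>\<^sup>+\<omega>. ennreal ((g + c * I \<omega>)\<^sup>2) \<partial>M)"
proof (rule ennreal_le_of_le_one_plus)
  fix e :: real assume e: "e > 0"
  let ?N = "field_measure M L"
  let ?V = "\<integral>\<^sup>+\<omega>. ennreal ((g + c * I \<omega>)\<^sup>2) \<partial>M"
  let ?k = "ennreal (1 + 1 / e)"
  have fm: "f \<in> borel_measurable ?N" and Im: "I \<in> borel_measurable M"
    using I predictable_imp_field_measurable by (auto simp: has_walsh_integral_def)
  obtain es where es: "\<And>n. simple_field M F L (es n)"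
    and a: "(\<lambda>n. \<integral>\<^sup>+ p. ennreal ((simple_field_fun (es n) p - f p)\<^sup>2) \<partial>?N) \<longlonglongrightarrow> 0" (is "?a \<longlonglongrightarrow> 0")
    and d: "(\<lambda>n. \<integral>\<^sup>+ \<omega>. ennreal ((simple_walsh_integral W (es n) \<omega> - I \<omega>)\<^sup>2) \<partial>M) \<longlonglongrightarrow> 0" (is "?d \<longlonglongrightarrow> 0")
    using I unfolding has_walsh_integral_def by blast
  have "ennreal (g\<^sup>2) + ennreal (c\<^sup>2) * (\<integral>\<^sup>+p. ennreal ((f p)\<^sup>2) \<partial>?N)
     \<le> ennreal ((1 + e)\<^sup>2) * ?V + (ennreal (1 + e) * (?k * ennreal (c\<^sup>2)) * ?d n + ennreal (c\<^sup>2) * ?k * ?a n)" for n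
  proof -
    let ?s = "simple_field_fun (es n)" and ?S = "simple_walsh_integral W (es n)"
    let ?A = "\<integral>\<^sup>+p. ennreal ((?s p)\<^sup>2) \<partial>?N"
    have sm: "?s \<in> borel_measurable ?N" by (rule simple_field_fun_measurable[OF es])
    have Sm: "?S \<in> borel_measurable M"
      using simple_walsh_mean[OF es, of n] by (auto simp: has_bochner_integral_iff)
    have 1: "(\<integral>\<^sup>+p. ennreal ((f p)\<^sup>2) \<partial>?N) \<le> ennreal (1 + e) * ?A + ?k * ?a n"
      using nn_integral_power2_add_le[of ?s ?N "\<lambda>p. f p - ?s p" e] fm sm e
      by (simp add: power2_commute[of "f _" "?s _"])
    have 2: "(\<integral>\<^sup>+\<omega>. ennreal ((g + c * ?S \<omega>)\<^sup>2) \<partial>M) \<le> ennreal (1 + e) * ?V + ?k * (ennreal (c\<^sup>2) * ?d n)"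
    proof -
      have "(g + c * ?S \<omega>)\<^sup>2 = (g + c * I \<omega> + c * (?S \<omega> - I \<omega>))\<^sup>2" for \<omega> by (simp add: algebra_simps)
      moreover have "(\<integral>\<^sup>+\<omega>. ennreal ((c * (?S \<omega> - I \<omega>))\<^sup>2) \<partial>M) = ennreal (c\<^sup>2) * ?d n"
        using Sm Im by (subst nn_integral_cmult[symmetric]) (auto simp: power_mult_distrib ennreal_mult)
      ultimately show ?thesis
        using nn_integral_power2_add_le[of "\<lambda>\<omega>. g + c * I \<omega>" M "\<lambda>\<omega>. c * (?S \<omega> - I \<omega>)" e] Sm Im e by simp
    qed
    have e1: "1 \<le> ennreal (1 + e)" using e by (simp add: ennreal_1[symmetric] del: ennreal_1)
    have "ennreal (g\<^sup>2) + ennreal (c\<^sup>2) * (\<integral>\<^sup>+p. ennreal ((f p)\<^sup>2) \<partial>?N)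
      \<le> ennreal (1 + e) * ennreal (g\<^sup>2) + ennreal (c\<^sup>2) * (ennreal (1 + e) * ?A + ?k * ?a n)"
      using mult_right_mono[OF e1, of "ennreal (g\<^sup>2)"] by (intro add_mono mult_left_mono 1) auto
    also have "\<dots> = ennreal (1 + e) * (ennreal (g\<^sup>2) + ennreal (c\<^sup>2) * ?A) + ennreal (c\<^sup>2) * ?k * ?a n"
      by (simp add: algebra_simps)
    also have "ennreal (g\<^sup>2) + ennreal (c\<^sup>2) * ?A = (\<integral>\<^sup>+\<omega>. ennreal ((g + c * ?S \<omega>)\<^sup>2) \<partial>M)"
      by (rule second_moment_affine_simple_walsh[OF es, symmetric])
    also have "ennreal (1 + e) * \<dots> + ennreal (c\<^sup>2) * ?k * ?a n
      \<le> ennreal (1 + e) * (ennreal (1 + e) * ?V + ?k * (ennreal (c\<^sup>2) * ?d n)) + ennreal (c\<^sup>2) * ?k * ?a n"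
      by (intro add_right_mono mult_left_mono 2) auto
    also have "\<dots> = ennreal ((1 + e)\<^sup>2) * ?V + (ennreal (1 + e) * (?k * ennreal (c\<^sup>2)) * ?d n + ennreal (c\<^sup>2) * ?k * ?a n)"
    proof -
      have "ennreal ((1 + e)\<^sup>2) = ennreal (1 + e) * ennreal (1 + e)"
        using e by (simp add: power2_eq_square ennreal_mult)
      then show ?thesis by (simp only: distrib_left mult.assoc add.assoc)
    qed
    finally show ?thesis .
  qed
  moreover have "(\<lambda>n. ennreal ((1 + e)\<^sup>2) * ?V + (ennreal (1 + e) * (?k * ennreal (c\<^sup>2)) * ?d n + ennreal (c\<^sup>2) * ?k * ?a n))
     \<longlonglongrightarrow> ennreal ((1 + e)\<^sup>2) * ?V + (ennreal (1 + e) * (?k * ennreal (c\<^sup>2)) * 0 + ennreal (c\<^sup>2) * ?k * 0)"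
    by (intro tendsto_add tendsto_const ennreal_tendsto_cmult a d) (auto simp: ennreal_mult_less_top)
  ultimately show "ennreal (g\<^sup>2) + ennreal (c\<^sup>2) * (\<integral>\<^sup>+p. ennreal ((f p)\<^sup>2) \<partial>?N) \<le> ennreal ((1 + e)\<^sup>2) * ?V"
    by (intro LIMSEQ_le_const[where X="\<lambda>n. ennreal ((1 + e)\<^sup>2) * ?V
       + (ennreal (1 + e) * (?k * ennreal (c\<^sup>2)) * ?d n + ennreal (c\<^sup>2) * ?k * ?a n)"]) auto
qed

end

section \<open>Second moments of mild solutions\<close>

lemma borel_measurable_of_restrict_lborel:
  "f \<in> measurable N (restrict_space lborel S) \<Longrightarrow> f \<in> borel_measurable N"
  by (simp add: measurable_restrict_space2_iff)

lemma sigma_finite_restrict_lborel: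
  "S \<in> sets borel \<Longrightarrow> sigma_finite_measure (restrict_space lborel S)"
  by (intro sigma_finite_measure_restrict_space sigma_finite_lborel) simp

locale fractional_heat = white_noise M F L W + dirichlet_kernel L \<beta>
  for M :: "'a measure" and F L W \<beta> +
  fixes lam l :: real and u0 \<sigma> :: "real \<Rightarrow> real" and u :: "real \<Rightarrow> real \<Rightarrow> 'a \<Rightarrow> real"
  assumes lam: "lam > 0" and l: "l > 0" and sigma_lower: "\<And>x. l * \<bar>x\<bar> \<le> \<bar>\<sigma> x\<bar>"
    and u0_int: "integrable (lebesgue_on {0..L}) u0"
    and u0_pos: "(\<integral>y. u0 y * dir_eigenfun L 1 y \<partial>lebesgue_on {0..L}) > 0"
    and sol: "mild_solution M F L W \<beta> lam \<sigma> u0 u"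
begin

abbreviation "TT \<equiv> restrict_space lborel {0::real<..}"
abbreviation "v t x \<equiv> second_moment M (u t x)"
abbreviation "P \<equiv> TT \<Otimes>\<^sub>M X"

definition weighted_moment :: "real \<Rightarrow> ennreal" where
  "weighted_moment t = (\<integral>\<^sup>+x. ennreal ((\<phi> x)\<^sup>2) * v t x \<partial>X)"

sublocale TT: sigma_finite_measure TT
  by (rule sigma_finite_restrict_lborel) simp

sublocale X: sigma_finite_measure X
  by (rule sigma_finite_restrict_lborel) simp

sublocale TX: pair_sigma_finite TT X ..

sublocale XM: pair_sigma_finite X M ..

sublocale XP: pair_sigma_finite X P
  by (intro pair_sigma_finite.intro X.sigma_finite_measure_axioms TX.sigma_finite_measure_axioms)

lemma fst_P [measurable]: "fst \<in> borel_measurable P"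
  by (rule borel_measurable_of_restrict_lborel) (rule measurable_fst)

lemma snd_P [measurable]: "snd \<in> borel_measurable P"
  by (rule borel_measurable_of_restrict_lborel) (rule measurable_snd)

lemma u_field: "(\<lambda>(t, x, \<omega>). u t x \<omega>) \<in> borel_measurable (TT \<Otimes>\<^sub>M (X \<Otimes>\<^sub>M M))"
  using sol predictable_imp_field_measurable[of "\<lambda>(t, x, \<omega>). u t x \<omega>"]
  unfolding mild_solution_def field_measure_def by blast

lemma v_meas: "(\<lambda>p. v (fst p) (snd p)) \<in> borel_measurable P"
proof -
  \<comment> \<open>Fields live on time times (space times \<omega>), whereas integrating out
    \<omega> needs (time times space) times \<omega>; this map regroups the product.\<close>
  have "(\<lambda>q. (fst (fst q), snd (fst q), snd q)) \<in> P \<Otimes>\<^sub>M M \<rightarrow>\<^sub>M TT \<Otimes>\<^sub>M (X \<Otimes>\<^sub>M M)"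
    by (intro measurable_Pair measurable_compose[OF measurable_fst measurable_fst]
      measurable_compose[OF measurable_fst measurable_snd] measurable_snd)
  from measurable_compose[OF this u_field]
  have "(\<lambda>q. u (fst (fst q)) (snd (fst q)) (snd q)) \<in> borel_measurable (P \<Otimes>\<^sub>M M)" by (simp only: prod.case)
  then have "(\<lambda>q. ennreal (\<bar>u (fst (fst q)) (snd (fst q)) (snd q)\<bar>\<^sup>2)) \<in> borel_measurable (P \<Otimes>\<^sub>M M)"
    by measurable
  then show ?thesis unfolding second_moment_def
    by (intro borel_measurable_nn_integral) (simp only: case_prod_beta')
qed

text \<open>Despite the name it carries the second moment \<open>v\<close>: it is the expected
  square of the integrand of the mild equation with \<sigma>(u) replaced by u.\<close>

definition heat_kernel2 :: "real \<Rightarrow> real \<Rightarrow> real \<times> real \<Rightarrow> ennreal" where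
  "heat_kernel2 t x p = ennreal (indicator {0<..<t} (fst p) * (G_D L \<beta> (t - fst p) x (snd p))\<^sup>2) * v (fst p) (snd p)"

lemma heat_kernel2_meas: "(\<lambda>q. heat_kernel2 t (fst q) (snd q)) \<in> borel_measurable (X \<Otimes>\<^sub>M P)"
proof -
  have [measurable]: "(\<lambda>q. fst (snd q)) \<in> borel_measurable (X \<Otimes>\<^sub>M P)"
    "(\<lambda>q. snd (snd q)) \<in> borel_measurable (X \<Otimes>\<^sub>M P)"
    "(\<lambda>q. v (fst (snd q)) (snd (snd q))) \<in> borel_measurable (X \<Otimes>\<^sub>M P)"
    "fst \<in> borel_measurable (X \<Otimes>\<^sub>M P)"
    by (rule measurable_compose[OF measurable_snd fst_P] measurable_compose[OF measurable_snd snd_P]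
      measurable_compose[OF measurable_snd v_meas] borel_measurable_of_restrict_lborel[OF measurable_fst])+
  have [measurable]: "(\<lambda>q. G_D L \<beta> (t - fst (snd q)) (fst q) (snd (snd q))) \<in> borel_measurable (X \<Otimes>\<^sub>M P)"
    by (intro measurable_G_D) measurable
  show ?thesis unfolding heat_kernel2_def by measurable
qed

text \<open>The isometry bound with the deterministic part as g, followed by \<sigma>(u)^2 >= l^2
  u^2 and by Tonelli, which moves the expectation inside and produces \<open>v\<close>.\<close>

lemma second_moment_ge:
  assumes t: "t > 0" and x: "x \<in> {0..L}"
  shows "ennreal ((G_D_op L \<beta> u0 t x)\<^sup>2) + ennreal (lam\<^sup>2 * l\<^sup>2) * (\<integral>\<^sup>+p. heat_kernel2 t x p \<partial>P) \<le> v t x"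
proof -
  let ?g = "G_D_op L \<beta> u0 t x"
  let ?f = "\<lambda>(s, y, \<omega>). indicator {0<..<t} s * G_D L \<beta> (t - s) x y * \<sigma> (u s y \<omega>)"
  obtain I where I: "has_walsh_integral M F L W ?f I" and ae: "AE \<omega> in M. u t x \<omega> = ?g + lam * I \<omega>"
    using sol t x unfolding mild_solution_def by blast
  have "v t x = (\<integral>\<^sup>+\<omega>. ennreal ((?g + lam * I \<omega>)\<^sup>2) \<partial>M)"
    unfolding second_moment_def by (rule nn_integral_cong_AE) (use ae in auto)
  then have ge: "ennreal (?g\<^sup>2) + ennreal (lam\<^sup>2) * (\<integral>\<^sup>+p. ennreal ((?f p)\<^sup>2) \<partial>field_measure M L) \<le> v t x"
    using walsh_second_moment_ge[OF I, of ?g lam] by simp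
  let ?c = "\<lambda>s y. ennreal (l\<^sup>2) * ennreal (indicator {0<..<t} s * (G_D L \<beta> (t - s) x y)\<^sup>2)"
  let ?h = "\<lambda>q. ?c (fst q) (fst (snd q)) * ennreal ((u (fst q) (fst (snd q)) (snd (snd q)))\<^sup>2)"
  have um: "(\<lambda>q. u (fst q) (fst (snd q)) (snd (snd q))) \<in> borel_measurable (TT \<Otimes>\<^sub>M (X \<Otimes>\<^sub>M M))"
    using u_field by (simp add: case_prod_beta')
  have cm: "(\<lambda>q. ?c (fst q) (fst (snd q))) \<in> borel_measurable (TT \<Otimes>\<^sub>M (X \<Otimes>\<^sub>M M))"
  proof -
    have [measurable]: "fst \<in> borel_measurable (TT \<Otimes>\<^sub>M (X \<Otimes>\<^sub>M M))"
      "(\<lambda>q. fst (snd q)) \<in> borel_measurable (TT \<Otimes>\<^sub>M (X \<Otimes>\<^sub>M M))"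
      by (rule borel_measurable_of_restrict_lborel[OF measurable_fst]
          borel_measurable_of_restrict_lborel[OF measurable_compose[OF measurable_snd measurable_fst]])+
    have [measurable]: "(\<lambda>q. G_D L \<beta> (t - fst q) x (fst (snd q))) \<in> borel_measurable (TT \<Otimes>\<^sub>M (X \<Otimes>\<^sub>M M))"
      by (intro measurable_G_D) measurable
    show ?thesis by measurable
  qed
  have hm: "?h \<in> borel_measurable (TT \<Otimes>\<^sub>M (X \<Otimes>\<^sub>M M))"
    by (intro borel_measurable_times_ennreal cm) (use um in measurable)
  have km: "(\<lambda>p. heat_kernel2 t x p) \<in> borel_measurable P"
    using x by (intro measurable_compose[OF measurable_Pair1' heat_kernel2_meas[of t], simplified])
      (simp add: space_restrict_space)
  have "ennreal (l\<^sup>2) * (\<integral>\<^sup>+p. heat_kernel2 t x p \<partial>P) = (\<integral>\<^sup>+p. ennreal (l\<^sup>2) * heat_kernel2 t x p \<partial>P)"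
    using km by (rule nn_integral_cmult[symmetric])
  also have "\<dots> = (\<integral>\<^sup>+s. \<integral>\<^sup>+y. ennreal (l\<^sup>2) * heat_kernel2 t x (s, y) \<partial>X \<partial>TT)"
    using km by (intro X.nn_integral_fst[symmetric]) simp
  also have "\<dots> = (\<integral>\<^sup>+s. \<integral>\<^sup>+y. \<integral>\<^sup>+\<omega>. ?h (s, y, \<omega>) \<partial>M \<partial>X \<partial>TT)"
  proof (intro nn_integral_cong)
    fix s y assume sy: "s \<in> space TT" "y \<in> space X"
    have "(\<lambda>\<omega>. (s, y, \<omega>)) \<in> M \<rightarrow>\<^sub>M TT \<Otimes>\<^sub>M (X \<Otimes>\<^sub>M M)"
      using sy by (intro measurable_Pair measurable_const measurable_ident) auto
    from measurable_compose[OF this um] have "(\<lambda>\<omega>. u s y \<omega>) \<in> borel_measurable M" by simp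
    then have "(\<integral>\<^sup>+\<omega>. ?c s y * ennreal ((u s y \<omega>)\<^sup>2) \<partial>M) = ?c s y * (\<integral>\<^sup>+\<omega>. ennreal ((u s y \<omega>)\<^sup>2) \<partial>M)"
      by (intro nn_integral_cmult) measurable
    then show "ennreal (l\<^sup>2) * heat_kernel2 t x (s, y) = (\<integral>\<^sup>+\<omega>. ?h (s, y, \<omega>) \<partial>M)"
      by (simp add: heat_kernel2_def second_moment_def mult.assoc)
  qed
  also have "\<dots> = (\<integral>\<^sup>+s. \<integral>\<^sup>+q. ?h (s, q) \<partial>(X \<Otimes>\<^sub>M M) \<partial>TT)"
  proof (intro nn_integral_cong)
    fix s assume s: "s \<in> space TT"
    show "(\<integral>\<^sup>+y. \<integral>\<^sup>+\<omega>. ?h (s, y, \<omega>) \<partial>M \<partial>X) = (\<integral>\<^sup>+q. ?h (s, q) \<partial>(X \<Otimes>\<^sub>M M))"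
      by (rule nn_integral_fst) (rule measurable_compose[OF measurable_Pair1'[OF s] hm])
  qed
  also have "\<dots> = (\<integral>\<^sup>+q. ?h q \<partial>field_measure M L)"
    unfolding field_measure_def
    by (rule sigma_finite_measure.nn_integral_fst[OF XM.sigma_finite_measure_axioms hm])
  also have "\<dots> \<le> (\<integral>\<^sup>+p. ennreal ((?f p)\<^sup>2) \<partial>field_measure M L)"
  proof (intro nn_integral_mono)
    fix q :: "real \<times> real \<times> 'a"
    obtain s y \<omega> where q: "q = (s, y, \<omega>)" by (metis prod.exhaust)
    have "(l * \<bar>u s y \<omega>\<bar>)\<^sup>2 \<le> \<bar>\<sigma> (u s y \<omega>)\<bar>\<^sup>2"
      using l sigma_lower by (intro power_mono) auto
    then have "(indicator {0<..<t} s * (G_D L \<beta> (t - s) x y)\<^sup>2) * (l\<^sup>2 * (u s y \<omega>)\<^sup>2)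
      \<le> (indicator {0<..<t} s * (G_D L \<beta> (t - s) x y)\<^sup>2) * (\<sigma> (u s y \<omega>))\<^sup>2"
      by (intro mult_left_mono) (auto simp: power_mult_distrib)
    then have "ennreal ((indicator {0<..<t} s * (G_D L \<beta> (t - s) x y)\<^sup>2) * (l\<^sup>2 * (u s y \<omega>)\<^sup>2))
      \<le> ennreal ((?f q)\<^sup>2)"
      unfolding q by (intro ennreal_leI) (auto simp: power_mult_distrib indicator_def)
    also have "ennreal ((indicator {0<..<t} s * (G_D L \<beta> (t - s) x y)\<^sup>2) * (l\<^sup>2 * (u s y \<omega>)\<^sup>2)) = ?h q"
      unfolding q by (simp add: ennreal_mult[symmetric] mult_ac)
    finally show "?h q \<le> ennreal ((?f q)\<^sup>2)" .
  qed
  finally have "ennreal (lam\<^sup>2) * (ennreal (l\<^sup>2) * (\<integral>\<^sup>+p. heat_kernel2 t x p \<partial>P))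
     \<le> ennreal (lam\<^sup>2) * (\<integral>\<^sup>+p. ennreal ((?f p)\<^sup>2) \<partial>field_measure M L)"
    by (rule mult_left_mono) simp
  moreover have "ennreal (lam\<^sup>2 * l\<^sup>2) * (\<integral>\<^sup>+p. heat_kernel2 t x p \<partial>P) = ennreal (lam\<^sup>2) * (ennreal (l\<^sup>2) * (\<integral>\<^sup>+p. heat_kernel2 t x p \<partial>P))"
    by (simp add: ennreal_mult mult.assoc)
  ultimately have "ennreal (lam\<^sup>2 * l\<^sup>2) * (\<integral>\<^sup>+p. heat_kernel2 t x p \<partial>P)
    \<le> ennreal (lam\<^sup>2) * (\<integral>\<^sup>+p. ennreal ((?f p)\<^sup>2) \<partial>field_measure M L)"
    by (simp only:)
  from order_trans[OF add_left_mono[OF this] ge] show ?thesis .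
qed

abbreviation "mass \<equiv> \<integral>y. u0 y * \<phi> y \<partial>lebesgue_on {0..L}"

lemma phi2_meas [measurable]: "(\<lambda>x. ennreal ((\<phi> x)\<^sup>2)) \<in> borel_measurable borel"
  by measurable

text \<open>The factor v s y does not involve x, so Cauchy-Schwarz acts on \<phi>(x) G_D(t-s,x,y)
  alone and the reproducing property gives \<phi>(y)^2 back. For s outside (0,t) the left-hand side
  is 0.\<close>

lemma heat_kernel2_integral_ge:
  assumes t: "t > 0" and p: "p \<in> space P"
  shows "ennreal (indicator {0<..<t} (fst p) * (eig 0 (t - fst p))\<^sup>2 / L) *
      (ennreal ((\<phi> (snd p))\<^sup>2) * v (fst p) (snd p)) \<le> (\<integral>\<^sup>+x. ennreal ((\<phi> x)\<^sup>2) * heat_kernel2 t x p \<partial>X)"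
proof (cases "fst p \<in> {0<..<t}")
  case True
  obtain s y where q: "p = (s, y)" by (cases p)
  have ts: "t - s > 0" using True q by auto
  have gm: "(\<lambda>x. ennreal ((\<phi> x * G_D L \<beta> (t - s) x y)\<^sup>2)) \<in> borel_measurable X"
    by (intro measurable_X) measurable
  have "ennreal ((eig 0 (t - s) * \<phi> y)\<^sup>2 / L) \<le> (\<integral>\<^sup>+x. ennreal ((\<phi> x * G_D L \<beta> (t - s) x y)\<^sup>2) \<partial>X)"
    by (rule power2_integral_le[OF phi_integral_G_D[OF ts]])
  then have "ennreal ((eig 0 (t - s) * \<phi> y)\<^sup>2 / L) * v s y
    \<le> (\<integral>\<^sup>+x. ennreal ((\<phi> x * G_D L \<beta> (t - s) x y)\<^sup>2) \<partial>X) * v s y"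
    by (rule mult_right_mono) simp
  also have "\<dots> = (\<integral>\<^sup>+x. ennreal ((\<phi> x * G_D L \<beta> (t - s) x y)\<^sup>2) * v s y \<partial>X)"
    by (rule nn_integral_multc[OF gm, symmetric])
  also have "\<dots> = (\<integral>\<^sup>+x. ennreal ((\<phi> x)\<^sup>2) * heat_kernel2 t x p \<partial>X)"
    using True unfolding q by (simp add: heat_kernel2_def power_mult_distrib ennreal_mult mult_ac)
  also have "ennreal ((eig 0 (t - s) * \<phi> y)\<^sup>2 / L) * v s y
    = ennreal (indicator {0<..<t} s * (eig 0 (t - s))\<^sup>2 / L) * (ennreal ((\<phi> y)\<^sup>2) * v s y)"
    using True L unfolding q
    by (simp add: power_mult_distrib ennreal_mult[symmetric] mult.assoc[symmetric])
  finally show ?thesis unfolding q by simp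
qed simp

text \<open>\<open>second_moment_ge\<close> is integrated against \<phi>^2; Tonelli brings the
  x-integral inside, where \<open>heat_kernel2_integral_ge\<close> turns the weight at time t into
  the weight at time s.\<close>

lemma weighted_moment_ge:
  assumes t: "t > 0"
  shows "ennreal (mass\<^sup>2 / L * (eig 0 t)\<^sup>2)
    + (\<integral>\<^sup>+s. ennreal (lam\<^sup>2 * l\<^sup>2 / L * (eig 0 (t - s))\<^sup>2) * weighted_moment s * indicator {0<..<t} s \<partial>lborel) \<le> weighted_moment t"
proof -
  let ?\<kappa> = "ennreal (lam\<^sup>2 * l\<^sup>2)"
  let ?g = "G_D_op L \<beta> u0 t"
  let ?e = "\<lambda>s. indicator {0<..<t} s * (eig 0 (t - s))\<^sup>2 / L"
  have gm: "(\<lambda>x. ennreal ((\<phi> x * ?g x)\<^sup>2)) \<in> borel_measurable X"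
    using measurable_G_D_op[OF u0_int t] by (intro measurable_X) measurable
  have pk: "(\<lambda>q. ennreal ((\<phi> (fst q))\<^sup>2) * heat_kernel2 t (fst q) (snd q)) \<in> borel_measurable (X \<Otimes>\<^sub>M P)"
    by (intro borel_measurable_times_ennreal heat_kernel2_meas measurable_compose[OF measurable_fst measurable_X[OF phi2_meas]])
  have ik: "(\<lambda>x. \<integral>\<^sup>+p. ennreal ((\<phi> x)\<^sup>2) * heat_kernel2 t x p \<partial>P) \<in> borel_measurable X"
    using pk by (intro TX.borel_measurable_nn_integral) (simp add: case_prod_beta')
  have kx: "(\<lambda>p. heat_kernel2 t x p) \<in> borel_measurable P" if "x \<in> space X" for x
    using measurable_compose[OF measurable_Pair1'[OF that] heat_kernel2_meas[of t]] by simp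
  have em: "(\<lambda>s. ennreal (?e s)) \<in> borel_measurable borel"
    unfolding eig_def by measurable
  have pv: "(\<lambda>p. ennreal ((\<phi> (snd p))\<^sup>2) * v (fst p) (snd p)) \<in> borel_measurable P"
    by (intro borel_measurable_times_ennreal v_meas measurable_compose[OF snd_P phi2_meas])
  have "ennreal (mass\<^sup>2 / L * (eig 0 t)\<^sup>2) \<le> (\<integral>\<^sup>+x. ennreal ((\<phi> x * ?g x)\<^sup>2) \<partial>X)"
    using power2_integral_le[OF phi_integral_G_D_op[OF u0_int t]] by (simp add: power_mult_distrib mult.commute)
  moreover have "(\<integral>\<^sup>+s. ennreal (lam\<^sup>2 * l\<^sup>2 / L * (eig 0 (t - s))\<^sup>2) * weighted_moment s * indicator {0<..<t} s \<partial>lborel)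
     \<le> (\<integral>\<^sup>+x. ?\<kappa> * (\<integral>\<^sup>+p. ennreal ((\<phi> x)\<^sup>2) * heat_kernel2 t x p \<partial>P) \<partial>X)"
  proof -
    have "(\<integral>\<^sup>+s. ennreal (lam\<^sup>2 * l\<^sup>2 / L * (eig 0 (t - s))\<^sup>2) * weighted_moment s * indicator {0<..<t} s \<partial>lborel)
      = (\<integral>\<^sup>+s. ?\<kappa> * (ennreal (?e s) * weighted_moment s) * indicator {0<..} s \<partial>lborel)"
    proof (intro nn_integral_cong)
      fix s
      have "ennreal (lam\<^sup>2 * l\<^sup>2 / L * (eig 0 (t - s))\<^sup>2) = ?\<kappa> * ennreal ((eig 0 (t - s))\<^sup>2 / L)"
        using L by (subst ennreal_mult[symmetric]) auto
      then show "ennreal (lam\<^sup>2 * l\<^sup>2 / L * (eig 0 (t - s))\<^sup>2) * weighted_moment s * indicator {0<..<t} s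
        = ?\<kappa> * (ennreal (?e s) * weighted_moment s) * indicator {0<..} s"
        by (simp add: indicator_def mult.assoc)
    qed
    also have "\<dots> = (\<integral>\<^sup>+s. ?\<kappa> * (ennreal (?e s) * weighted_moment s) \<partial>TT)"
      by (subst nn_integral_restrict_space) auto
    also have "\<dots> = (\<integral>\<^sup>+s. \<integral>\<^sup>+y. ?\<kappa> * (ennreal (?e s) * (ennreal ((\<phi> y)\<^sup>2) * v s y)) \<partial>X \<partial>TT)"
    proof (intro nn_integral_cong)
      fix s assume s: "s \<in> space TT"
      have "(\<lambda>y. ennreal ((\<phi> y)\<^sup>2) * v s y) \<in> borel_measurable X"
        using measurable_compose[OF measurable_Pair1'[OF s] pv] by simp
      then show "?\<kappa> * (ennreal (?e s) * weighted_moment s)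
          = (\<integral>\<^sup>+y. ?\<kappa> * (ennreal (?e s) * (ennreal ((\<phi> y)\<^sup>2) * v s y)) \<partial>X)"
        unfolding weighted_moment_def by (simp add: nn_integral_cmult)
    qed
    also have "\<dots> = (\<integral>\<^sup>+p. ?\<kappa> * (ennreal (?e (fst p)) * (ennreal ((\<phi> (snd p))\<^sup>2) * v (fst p) (snd p))) \<partial>P)"
      using X.nn_integral_fst[of "\<lambda>p. ?\<kappa> * (ennreal (?e (fst p)) * (ennreal ((\<phi> (snd p))\<^sup>2) * v (fst p) (snd p)))" TT]
        pv measurable_compose[OF fst_P em]
      by (simp add: borel_measurable_times_ennreal)
    also have "\<dots> \<le> (\<integral>\<^sup>+p. ?\<kappa> * (\<integral>\<^sup>+x. ennreal ((\<phi> x)\<^sup>2) * heat_kernel2 t x p \<partial>X) \<partial>P)"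
      by (intro nn_integral_mono mult_left_mono heat_kernel2_integral_ge t) auto
    also have "\<dots> = ?\<kappa> * (\<integral>\<^sup>+p. \<integral>\<^sup>+x. ennreal ((\<phi> x)\<^sup>2) * heat_kernel2 t x p \<partial>X \<partial>P)"
      using measurable_compose[OF measurable_pair_swap' pk]
      by (intro nn_integral_cmult X.borel_measurable_nn_integral) (simp add: case_prod_beta')
    also have "(\<integral>\<^sup>+p. \<integral>\<^sup>+x. ennreal ((\<phi> x)\<^sup>2) * heat_kernel2 t x p \<partial>X \<partial>P) = (\<integral>\<^sup>+x. \<integral>\<^sup>+p. ennreal ((\<phi> x)\<^sup>2) * heat_kernel2 t x p \<partial>P \<partial>X)"
      using XP.Fubini[OF pk] by simp
    also have "?\<kappa> * \<dots> = (\<integral>\<^sup>+x. ?\<kappa> * (\<integral>\<^sup>+p. ennreal ((\<phi> x)\<^sup>2) * heat_kernel2 t x p \<partial>P) \<partial>X)"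
      by (rule nn_integral_cmult[OF ik, symmetric])
    finally show ?thesis .
  qed
  ultimately have "ennreal (mass\<^sup>2 / L * (eig 0 t)\<^sup>2)
    + (\<integral>\<^sup>+s. ennreal (lam\<^sup>2 * l\<^sup>2 / L * (eig 0 (t - s))\<^sup>2) * weighted_moment s * indicator {0<..<t} s \<partial>lborel)
    \<le> (\<integral>\<^sup>+x. ennreal ((\<phi> x * ?g x)\<^sup>2) \<partial>X) + (\<integral>\<^sup>+x. ?\<kappa> * (\<integral>\<^sup>+p. ennreal ((\<phi> x)\<^sup>2) * heat_kernel2 t x p \<partial>P) \<partial>X)"
    by (rule add_mono)
  also have "\<dots> = (\<integral>\<^sup>+x. ennreal ((\<phi> x * ?g x)\<^sup>2) + ?\<kappa> * (\<integral>\<^sup>+p. ennreal ((\<phi> x)\<^sup>2) * heat_kernel2 t x p \<partial>P) \<partial>X)"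
    using gm ik by (intro nn_integral_add[symmetric] borel_measurable_times_ennreal) auto
  also have "\<dots> \<le> (\<integral>\<^sup>+x. ennreal ((\<phi> x)\<^sup>2) * v t x \<partial>X)"
  proof (intro nn_integral_mono)
    fix x assume x: "x \<in> space X"
    then have "x \<in> {0..L}" by (simp add: space_restrict_space)
    from mult_left_mono[OF second_moment_ge[OF t this], of "ennreal ((\<phi> x)\<^sup>2)"]
    have "ennreal ((\<phi> x)\<^sup>2) * (ennreal ((?g x)\<^sup>2) + ?\<kappa> * (\<integral>\<^sup>+p. heat_kernel2 t x p \<partial>P)) \<le> ennreal ((\<phi> x)\<^sup>2) * v t x"
      by simp
    also have "ennreal ((\<phi> x)\<^sup>2) * (ennreal ((?g x)\<^sup>2) + ?\<kappa> * (\<integral>\<^sup>+p. heat_kernel2 t x p \<partial>P))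
      = ennreal ((\<phi> x * ?g x)\<^sup>2) + ?\<kappa> * (ennreal ((\<phi> x)\<^sup>2) * (\<integral>\<^sup>+p. heat_kernel2 t x p \<partial>P))"
      by (simp add: distrib_left power_mult_distrib ennreal_mult mult.left_commute)
    also have "ennreal ((\<phi> x)\<^sup>2) * (\<integral>\<^sup>+p. heat_kernel2 t x p \<partial>P) = (\<integral>\<^sup>+p. ennreal ((\<phi> x)\<^sup>2) * heat_kernel2 t x p \<partial>P)"
      by (rule nn_integral_cmult[OF kx[OF x], symmetric])
    finally show "ennreal ((\<phi> x * ?g x)\<^sup>2) + ?\<kappa> * (\<integral>\<^sup>+p. ennreal ((\<phi> x)\<^sup>2) * heat_kernel2 t x p \<partial>P)
      \<le> ennreal ((\<phi> x)\<^sup>2) * v t x" .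
  qed
  finally show ?thesis by (simp add: weighted_moment_def)
qed

lemma weighted_moment_le_SUP: "weighted_moment t \<le> (SUP x\<in>{0..L}. v t x)"
proof -
  have "weighted_moment t \<le> (\<integral>\<^sup>+x. ennreal ((\<phi> x)\<^sup>2) * (SUP x\<in>{0..L}. v t x) \<partial>X)"
    unfolding weighted_moment_def by (intro nn_integral_mono mult_left_mono SUP_upper) (auto simp: space_restrict_space)
  also have "\<dots> = (\<integral>\<^sup>+x. ennreal ((\<phi> x)\<^sup>2) \<partial>X) * (SUP x\<in>{0..L}. v t x)"
    by (rule nn_integral_multc[OF measurable_X[OF phi2_meas]])
  also have "\<dots> = (SUP x\<in>{0..L}. v t x)" by (simp add: phi_power2_integral[simplified])
  finally show ?thesis .
qed

section \<open>Decay of the first mode and the two conclusions\<close>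

lemma eig_lower:
  obtains c where "c > 0" "\<And>r. r \<ge> 1 \<Longrightarrow> c / r powr \<beta> \<le> eig 0 r"
proof
  let ?K = "Gamma (1 - \<beta>) * dir_eigenval L (Suc 0)"
  have K: "?K \<ge> 0" using b dir_eigenval_pos[of 0] by simp
  then show "1 / (1 + ?K) > 0" by simp
  fix r :: real assume r: "r \<ge> 1"
  \<comment> \<open>For r >= 1 the constant in the denominator is absorbed: 1 + K r^\<beta> <= (1 +
    K) r^\<beta>.\<close>
  have "1 / (1 + ?K) / r powr \<beta> = 1 / (r powr \<beta> + ?K * r powr \<beta>)"
    by (simp add: field_simps)
  also have "\<dots> \<le> 1 / (1 + ?K * r powr \<beta>)"
    using r b K ge_one_powr_ge_zero[of r \<beta>] by (intro divide_left_mono) (auto intro!: mult_pos_pos add_pos_nonneg)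
  also have "\<dots> \<le> eig 0 r"
    unfolding eig_def using mittag_leffler_lower[OF b, of "dir_eigenval L (Suc 0)" r] dir_eigenval_pos[of 0] r by simp
  finally show "1 / (1 + ?K) / r powr \<beta> \<le> eig 0 r" .
qed

lemma no_exponential_decay:
  assumes "\<gamma> > 0" and le: "\<And>t. t \<ge> T \<Longrightarrow> (SUP x\<in>{0..L}. v t x) \<le> ennreal (C * exp (- \<gamma> * t))" and C: "C > 0"
  shows False
proof -
  obtain c where c: "c > 0" "\<And>r. r \<ge> 1 \<Longrightarrow> c / r powr \<beta> \<le> eig 0 r" using eig_lower by blast
  show False
  proof (rule exponential_decay_contradiction[of "mass\<^sup>2 / L * c\<^sup>2" \<gamma> "max T 1" C])
    show "mass\<^sup>2 / L * c\<^sup>2 > 0" using u0_pos L c by (intro mult_pos_pos divide_pos_pos) auto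
    fix t assume "t \<ge> max T 1"
    then have t: "t \<ge> 1" "t \<ge> T" by auto
    have "c / t \<le> c / t powr \<beta>"
      using t b c powr_mono[of \<beta> 1 t] by (intro divide_left_mono) auto
    also have "\<dots> \<le> eig 0 t" using c t by blast
    finally have "(c / t)\<^sup>2 \<le> (eig 0 t)\<^sup>2" using c t by (intro power_mono) auto
    then have "mass\<^sup>2 / L * (c / t)\<^sup>2 \<le> mass\<^sup>2 / L * (eig 0 t)\<^sup>2" using L by (intro mult_left_mono) auto
    then have "ennreal (mass\<^sup>2 / L * (c / t)\<^sup>2) \<le> ennreal (mass\<^sup>2 / L * (eig 0 t)\<^sup>2)" by (rule ennreal_leI)
    also have "\<dots> \<le> weighted_moment t" by (rule order_trans[OF _ weighted_moment_ge]) (use t in simp_all)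
    also have "\<dots> \<le> ennreal (C * exp (- \<gamma> * t))" using weighted_moment_le_SUP le[OF t(2)] by (rule order_trans)
    finally have "mass\<^sup>2 / L * (c / t)\<^sup>2 \<le> C * exp (- \<gamma> * t)"
      using C by (simp add: ennreal_le_iff)
    then show "mass\<^sup>2 / L * c\<^sup>2 / t\<^sup>2 \<le> C * exp (- \<gamma> * t)" by (simp add: power_divide)
  qed (fact assms(1))
qed

lemma exponential_growth:
  assumes half: "\<beta> \<le> 1 / 2"
  shows "\<exists>c \<gamma> T :: real. c > 0 \<and> \<gamma> > 0 \<and> T > 0 \<and>
    (\<forall>t\<ge>T. ennreal (c * exp (\<gamma> * t)) \<le> (SUP x\<in>{0..L}. v t x))"
proof -
  obtain c where c: "c > 0" "\<And>r. r \<ge> 1 \<Longrightarrow> c / r powr \<beta> \<le> eig 0 r" using eig_lower by blast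
  have "\<exists>c \<gamma> T :: real. c > 0 \<and> \<gamma> > 0 \<and> T > 0 \<and> (\<forall>t\<ge>T. ennreal (c * exp (\<gamma> * t)) \<le> weighted_moment t)"
  proof (rule renewal_exponential_growth[of "mass\<^sup>2 / L" "lam\<^sup>2 * l\<^sup>2 / L" "c\<^sup>2" "eig 0"])
    show "mass\<^sup>2 / L > 0" "lam\<^sup>2 * l\<^sup>2 / L > 0" "c\<^sup>2 > 0"
      using u0_pos L c lam l by (auto intro!: divide_pos_pos mult_pos_pos)
    fix r :: real assume r: "r \<ge> 1"
    \<comment> \<open>The condition \<beta> <= 1/2 enters here: r^(2\<beta>) <= r turns the decay
      bound into c^2 / r, whose integral up to infinity diverges.\<close>
    have "(r powr \<beta>)\<^sup>2 = r powr (2 * \<beta>)" using r by (simp add: powr_power)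
    also have "\<dots> \<le> r powr 1" using r half by (intro powr_mono) auto
    finally have "(r powr \<beta>)\<^sup>2 \<le> r" using r by simp
    then have "c\<^sup>2 / r \<le> c\<^sup>2 / (r powr \<beta>)\<^sup>2" using r by (intro divide_left_mono) auto
    also have "\<dots> = (c / r powr \<beta>)\<^sup>2" by (simp add: power_divide)
    also have "\<dots> \<le> (eig 0 r)\<^sup>2" using c r by (intro power_mono) auto
    finally show "c\<^sup>2 / r \<le> (eig 0 r)\<^sup>2" .
  next
    fix t :: real assume "t > 0"
    from weighted_moment_ge[OF this] show "ennreal (mass\<^sup>2 / L * (eig 0 t)\<^sup>2) \<le> weighted_moment t"
      by (rule order_trans[rotated]) simp
  next
    fix t :: real assume "t > 0"
    from weighted_moment_ge[OF this]
    show "(\<integral>\<^sup>+s. ennreal (lam\<^sup>2 * l\<^sup>2 / L * (eig 0 (t - s))\<^sup>2) * weighted_moment s * indicator {0<..<t} s \<partial>lborel) \<le> weighted_moment t"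
      by (rule order_trans[rotated]) simp
  qed (use eig_pos eig_antimono in auto)
  then show ?thesis using weighted_moment_le_SUP by (meson order_trans)
qed

end

theorem theorem1p1:
  fixes M :: "'a measure" and F :: "real \<Rightarrow> 'a measure"
    and W :: "(real \<times> real) set \<Rightarrow> 'a \<Rightarrow> real"
    and L \<beta> lam l\<^sub>\<sigma> L\<^sub>\<sigma> :: real
    and u0 \<sigma> :: "real \<Rightarrow> real"
    and u :: "real \<Rightarrow> real \<Rightarrow> 'a \<Rightarrow> real"
  assumes "L > 0" and "0 < \<beta>" and "\<beta> < 1" and "lam > 0"
    and "u0 \<in> borel_measurable (lebesgue_on {0..L})"
    and "\<And>x. x \<in> {0..L} \<Longrightarrow> 0 \<le> u0 x"
    and "bounded (u0 ` {0..L})"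
    and "emeasure lebesgue {x \<in> {0..L}. 0 < u0 x} > 0"
    and "\<exists>K. K-lipschitz_on UNIV \<sigma>"
    and "l\<^sub>\<sigma> > 0" and "L\<^sub>\<sigma> > 0"
    and "\<And>x. l\<^sub>\<sigma> * \<bar>x\<bar> \<le> \<bar>\<sigma> x\<bar>" and "\<And>x. \<bar>\<sigma> x\<bar> \<le> L\<^sub>\<sigma> * \<bar>x\<bar>"
    and "white_noise M F L W"
    and "mild_solution M F L W \<beta> lam \<sigma> u0 u"
  shows "\<not> (\<exists>C \<gamma> T :: real. C > 0 \<and> \<gamma> > 0 \<and> T > 0 \<and>
            (\<forall>t\<ge>T. (SUP x\<in>{0..L}. second_moment M (u t x)) \<le> ennreal (C * exp (- \<gamma> * t)))) \<and>
         (\<beta> \<le> 1 / 2 \<longrightarrow>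
          (\<exists>c \<gamma> T :: real. c > 0 \<and> \<gamma> > 0 \<and> T > 0 \<and>
            (\<forall>t\<ge>T. ennreal (c * exp (\<gamma> * t)) \<le> (SUP x\<in>{0..L}. second_moment M (u t x)))))"
proof -
  interpret dirichlet_kernel L \<beta> using assms(1-3) by unfold_locales
  note init = initial_mass_pos[OF assms(5-8)]
  interpret fractional_heat M F L W \<beta> lam l\<^sub>\<sigma> u0 \<sigma> u
    by (intro fractional_heat.intro fractional_heat_axioms.intro assms init dirichlet_kernel_axioms)
  show ?thesis
    using no_exponential_decay exponential_growth by blast
qed

end
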